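(* For $\alpha>\beta>0$ and $\delta,\rho>0$, $$\mathbf P_0\left(D^-_{H_\alpha}\le\delta\mid D^-_{H_\beta}=\rho\right)=\begin{cases}\displaystyle\exp\left(-\int_\beta^\alpha\frac{dS(z)}{S(z)-S(z-\delta)}\right),&\delta\ge\rho,\\[2mm]0,&\delta<\rho.\end{cases}$$
   Context: $X=(X_t)_{t\ge 0}$ is a regular one-dimensional diffusion in the sense of Itô and McKean (strong Markov, continuous paths) on an interval with left endpoint $l=-\infty$ and right endpoint $r=+\infty$, not killed inside it, started at $X_0=0$ under $\mathbf P_0$. The scale function $S$ is in $C^1$ and the speed measure has a continuous density with respect to Lebesgue measure. $X$ is either recurrent with $S(+\infty)=+\infty$, $S(-\infty)=-\infty$, or transient with $S(+\infty)<\infty$, $S(-\infty)=-\infty$. $M_t:=\max_{0\le s\le t}X_s$, $D^-_t:=\max_{0\le s\le t}(M_s-X_s)$, $H_\eta:=\inf\{t\ge0:X_t=\eta\}$, $\theta_\delta:=\inf\{t\ge0:M_t-X_t>\delta\}$. It is assumed that $\theta_\delta$ is a.s. finite for all $\delta$. The conditional probability given $D^-_{H_\beta}=\rho$ is understood as a regular conditional distribution. *)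

theory Defs
  imports "HOL-Probability.Probability"
begin

text \<open>
  Processes are indexed by real times \<open>t \<ge> 0\<close> and take values in \<open>ereal\<close>, so that a diffusion on
  the whole line may explode: \<open>X t \<omega> = \<plusminus>\<infinity>\<close> means that the path has reached that endpoint by time
  \<open>t\<close>. Random times take values in \<open>ereal\<close>, with \<open>Inf {} = \<infinity>\<close>.
\<close>

definition history :: "'w set \<Rightarrow> (real \<Rightarrow> 'w \<Rightarrow> ereal) \<Rightarrow> ereal \<Rightarrow> 'w measure" where
  "history \<Omega> X t =
     sigma \<Omega> {X s -` B \<inter> \<Omega> | s B. 0 \<le> s \<and> ereal s \<le> t \<and> B \<in> sets borel}"

text \<open>
  Stopping times of this right-continuous filtration are the Markov times of Ito and McKean. The
  index \<open>\<infinity>\<close> is inserted so that the intersection is not empty at \<open>t = \<infinity>\<close>.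
\<close>

definition history_plus :: "'w set \<Rightarrow> (real \<Rightarrow> 'w \<Rightarrow> ereal) \<Rightarrow> ereal \<Rightarrow> 'w measure" where
  "history_plus \<Omega> X t = sigma \<Omega> (\<Inter>u\<in>insert \<infinity> {t<..}. sets (history \<Omega> X u))"

definition hitting_time :: "(real \<Rightarrow> 'w \<Rightarrow> ereal) \<Rightarrow> real \<Rightarrow> 'w \<Rightarrow> ereal" where
  "hitting_time X \<eta> \<omega> = Inf {ereal t | t. 0 \<le> t \<and> X t \<omega> = ereal \<eta>}"

definition running_max :: "(real \<Rightarrow> 'w \<Rightarrow> ereal) \<Rightarrow> ereal \<Rightarrow> 'w \<Rightarrow> ereal" where
  "running_max X t \<omega> = (SUP s\<in>{s. 0 \<le> s \<and> ereal s \<le> t}. X s \<omega>)"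

definition max_drawdown :: "(real \<Rightarrow> 'w \<Rightarrow> ereal) \<Rightarrow> ereal \<Rightarrow> 'w \<Rightarrow> ereal" where
  "max_drawdown X t \<omega> =
     (SUP s\<in>{s. 0 \<le> s \<and> ereal s \<le> t}. running_max X (ereal s) \<omega> - X s \<omega>)"

text \<open>
  Only times before explosion count; without the finiteness condition the convention
  \<open>\<infinity> - \<infinity> = \<infinity>\<close> of \<open>ereal\<close> would turn an explosion to \<open>+\<infinity>\<close> into a drawdown.
\<close>

definition drawdown_time :: "(real \<Rightarrow> 'w \<Rightarrow> ereal) \<Rightarrow> real \<Rightarrow> 'w \<Rightarrow> ereal" where
  "drawdown_time X \<delta> \<omega> =
     Inf {ereal t | t. 0 \<le> t \<and> \<bar>X t \<omega>\<bar> \<noteq> \<infinity> \<and>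
            running_max X (ereal t) \<omega> - X t \<omega> > ereal \<delta>}"

text \<open>
  A regular diffusion on the line which is not killed at interior points. An endpoint that is
  reached in finite time is absorbing; equivalently, the process is stopped at its explosion time.
  Accordingly the strong Markov property is stated on the event that the stopping time precedes
  explosion; it concerns the law of the whole path after the stopping time.
\<close>

locale regular_diffusion =
  fixes N :: "'w measure" and P :: "real \<Rightarrow> 'w measure" and X :: "real \<Rightarrow> 'w \<Rightarrow> ereal"
  assumes prob_space_P: "prob_space (P x)"
    and sets_P: "sets (P x) = sets N"
    and measurable_X: "0 \<le> t \<Longrightarrow> X t \<in> N \<rightarrow>\<^sub>M borel"
    and measurable_P: "B \<in> sets (history (space N) X \<infinity>) \<Longrightarrow>
          (\<lambda>x. emeasure (P x) B) \<in> borel_measurable borel"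
    and start: "AE \<omega> in P x. X 0 \<omega> = ereal x"
    and continuous_paths: "\<omega> \<in> space N \<Longrightarrow> continuous_on {0..} (\<lambda>t. X t \<omega>)"
    and absorbed: "\<omega> \<in> space N \<Longrightarrow> 0 \<le> s \<Longrightarrow> s \<le> t \<Longrightarrow> \<bar>X s \<omega>\<bar> = \<infinity> \<Longrightarrow> X t \<omega> = X s \<omega>"
    and strong_markov:
      "stopping_time (history_plus (space N) X) \<tau> \<Longrightarrow> (\<And>\<omega>. \<omega> \<in> space N \<Longrightarrow> 0 \<le> \<tau> \<omega>) \<Longrightarrow>
       A \<in> sets (filtration.pre_sigma (space N) (history_plus (space N) X) \<tau>) \<Longrightarrow>
       C \<in> sets (\<Pi>\<^sub>M t\<in>{0..}. borel) \<Longrightarrow>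
       emeasure (P x) {\<omega>\<in>A. \<tau> \<omega> < \<infinity> \<and> \<bar>X (real_of_ereal (\<tau> \<omega>)) \<omega>\<bar> \<noteq> \<infinity> \<and>
           (\<lambda>t\<in>{0..}. X (real_of_ereal (\<tau> \<omega>) + t) \<omega>) \<in> C} =
       (\<integral>\<^sup>+\<omega>\<in>{\<omega>\<in>A. \<tau> \<omega> < \<infinity> \<and> \<bar>X (real_of_ereal (\<tau> \<omega>)) \<omega>\<bar> \<noteq> \<infinity>}.
           emeasure (P (real_of_ereal (X (real_of_ereal (\<tau> \<omega>)) \<omega>)))
             {\<omega>'\<in>space N. (\<lambda>t\<in>{0..}. X t \<omega>') \<in> C} \<partial>P x)"
    and regular: "measure (P x) {\<omega>\<in>space N. hitting_time X y \<omega> < \<infinity>} > 0"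

definition recurrent_diffusion ::
    "'w measure \<Rightarrow> (real \<Rightarrow> 'w measure) \<Rightarrow> (real \<Rightarrow> 'w \<Rightarrow> ereal) \<Rightarrow> bool" where
  "recurrent_diffusion N P X \<longleftrightarrow>
     (\<forall>x y. measure (P x) {\<omega>\<in>space N. hitting_time X y \<omega> < \<infinity>} = 1)"

definition transient_diffusion ::
    "'w measure \<Rightarrow> (real \<Rightarrow> 'w measure) \<Rightarrow> (real \<Rightarrow> 'w \<Rightarrow> ereal) \<Rightarrow> bool" where
  "transient_diffusion N P X \<longleftrightarrow> \<not> recurrent_diffusion N P X"

definition scale_function ::
    "'w measure \<Rightarrow> (real \<Rightarrow> 'w measure) \<Rightarrow> (real \<Rightarrow> 'w \<Rightarrow> ereal) \<Rightarrow> (real \<Rightarrow> real) \<Rightarrow> bool" where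
  "scale_function N P X S \<longleftrightarrow> strict_mono S \<and> continuous_on UNIV S \<and>
     (\<forall>a b x. a < b \<and> a \<le> x \<and> x \<le> b \<longrightarrow>
        measure (P x) {\<omega>\<in>space N. hitting_time X a \<omega> < hitting_time X b \<omega>} =
          (S b - S x) / (S b - S a))"

text \<open>
  The speed measure belonging to \<open>S\<close>, characterised through mean exit times and the Green function
  of \<open>(a, b)\<close>. The normalisation is that of the generator \<open>d/dm d/dS\<close>: for Brownian motion with
  \<open>S(x) = x\<close> one has \<open>m(dx) = 2 dx\<close>.
\<close>

definition green :: "(real \<Rightarrow> real) \<Rightarrow> real \<Rightarrow> real \<Rightarrow> real \<Rightarrow> real \<Rightarrow> real" where
  "green S a b x y = (S (min x y) - S a) * (S b - S (max x y)) / (S b - S a)"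

definition speed_measure ::
    "(real \<Rightarrow> 'w measure) \<Rightarrow> (real \<Rightarrow> 'w \<Rightarrow> ereal) \<Rightarrow> (real \<Rightarrow> real) \<Rightarrow> real measure \<Rightarrow> bool" where
  "speed_measure P X S m \<longleftrightarrow> sets m = sets borel \<and>
     (\<forall>K. compact K \<longrightarrow> emeasure m K < \<infinity>) \<and>
     (\<forall>a b x. a < x \<and> x < b \<longrightarrow>
        (\<integral>\<^sup>+\<omega>. e2ennreal (min (hitting_time X a \<omega>) (hitting_time X b \<omega>)) \<partial>P x) =
        (\<integral>\<^sup>+y\<in>{a<..<b}. ennreal (green S a b x y) \<partial>m))"

text \<open>\<open>\<kappa> z\<close> is the conditional law of \<open>Y\<close> given \<open>Z = z\<close>.\<close>

definition regular_conditional_distribution ::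
    "'w measure \<Rightarrow> 'b measure \<Rightarrow> ('w \<Rightarrow> 'b) \<Rightarrow> 'c measure \<Rightarrow> ('w \<Rightarrow> 'c) \<Rightarrow> ('c \<Rightarrow> 'b measure) \<Rightarrow> bool"
  where
  "regular_conditional_distribution M K Y L Z \<kappa> \<longleftrightarrow>
     Y \<in> M \<rightarrow>\<^sub>M K \<and> Z \<in> M \<rightarrow>\<^sub>M L \<and> \<kappa> \<in> L \<rightarrow>\<^sub>M prob_algebra K \<and>
     (\<forall>A\<in>sets K. \<forall>B\<in>sets L.
        emeasure M {\<omega>\<in>space M. Y \<omega> \<in> A \<and> Z \<omega> \<in> B} =
        (\<integral>\<^sup>+z\<in>B. emeasure (\<kappa> z) A \<partial>distr M L Z))"

end

theory Submission
  imports Defs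
begin

text \<open>
  To climb from \<open>x\<close> to \<open>z\<close> with all drawdowns at most \<open>\<delta>\<close>, the diffusion has to climb from \<open>x\<close> to an
  intermediate level \<open>y\<close> in this way and then from \<open>y\<close> to \<open>z\<close>. At the hitting time of \<open>y\<close> the path is at
  its running maximum, so no drawdown straddles this time: the drawdown at the hitting time of \<open>z\<close> is
  the maximum of the drawdown at the hitting time of \<open>y\<close> and of the drawdown of the path started
  afresh at \<open>y\<close> (\<open>max_drawdown_after_hitting\<close>). By the strong Markov property the two are independent
  (\<open>strong_markov_drawdown\<close>).

  This has two consequences. With \<open>x = 0\<close>, \<open>y = \<beta>\<close> and \<open>z = \<alpha>\<close> it shows that, given a drawdown \<open>\<rho>\<close> at
  the hitting time of \<open>\<beta>\<close>, the drawdown at the hitting time of \<open>\<alpha>\<close> is distributed like \<open>max \<rho> W\<close>, where \<open>W\<close>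
  has the law \<open>\<nu>\<close> of that drawdown under \<open>P \<beta>\<close> (\<open>regular_conditional_distribution_max\<close>). Its
  distribution function at \<open>\<delta>\<close> is zero if \<open>\<delta> < \<rho>\<close> and that of \<open>\<nu>\<close> otherwise. Other versions of the
  conditional law agree with this one almost everywhere (\<open>regular_conditional_distribution_AE_unique\<close>).

  Secondly, it shows that the probability \<open>G x y\<close> of climbing from \<open>x\<close> to \<open>y\<close> with drawdown at most \<open>\<delta>\<close>
  is multiplicative. For a short climb from \<open>u\<close> to \<open>v\<close> it is squeezed between exit probabilities: the drawdown
  is at most \<open>\<delta>\<close> if \<open>v\<close> is reached before \<open>v - \<delta>\<close>, and exceeds \<open>\<delta>\<close> if a level below \<open>u - \<delta>\<close> is reached
  before \<open>v\<close>. In terms of the scale function,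
  \<open>1 - (S v - S u) / (S v - S (v - \<delta>)) \<le> G u v \<le> 1 - (S v - S u) / (S v - S (u - \<delta>))\<close>,
  so that \<open>d G / G = - d S / (S z - S (z - \<delta>))\<close>, which integrates to the exponential formula
  (\<open>multiplicative_exp_integral\<close>, \<open>drawdown_probability\<close>). The upper level is hit almost surely because the
  exit times of bounded intervals have finite mean and \<open>S\<close> is unbounded below (\<open>hitting_time_finite\<close>).

  On the technical side, the strong Markov property speaks of events in the product space, on which
  suprema over all times are not measurable. All path functionals are therefore first rewritten as
  countable expressions that have the same value on continuous paths (\<open>max_drawdown_eq_rational\<close>).
\<close>

section \<open>Path functionals as countable expressions\<close>

abbreviation (input) hit_drawdown :: "(real \<Rightarrow> 'w \<Rightarrow> ereal) \<Rightarrow> real \<Rightarrow> 'w \<Rightarrow> ereal" where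
  "hit_drawdown X \<eta> \<omega> \<equiv> max_drawdown X (hitting_time X \<eta> \<omega>) \<omega>"

definition absorbing_path :: "(real \<Rightarrow> ereal) \<Rightarrow> bool" where
  "absorbing_path f \<longleftrightarrow> continuous_on {0..} f \<and>
     (\<forall>s t. 0 \<le> s \<longrightarrow> s \<le> t \<longrightarrow> \<bar>f s\<bar> = \<infinity> \<longrightarrow> f t = f s)"

lemma absorbing_path_continuous: "absorbing_path f \<Longrightarrow> continuous_on {0..} f"
  by (simp add: absorbing_path_def)

lemma absorbing_path_absorbed:
  "absorbing_path f \<Longrightarrow> 0 \<le> s \<Longrightarrow> s \<le> t \<Longrightarrow> \<bar>f s\<bar> = \<infinity> \<Longrightarrow> f t = f s"
  unfolding absorbing_path_def
  by (elim conjE allE[where x = s] allE[where x = t] impE) assumption+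

lemma absorbing_path_shift:
  assumes "absorbing_path f" "0 \<le> T"
  shows "absorbing_path (\<lambda>t. f (T + t))"
  unfolding absorbing_path_def
proof (intro conjI allI impI)
  show "continuous_on {0..} (\<lambda>t. f (T + t))"
    by (rule continuous_on_compose2[OF absorbing_path_continuous[OF assms(1)]])
      (use assms in \<open>auto intro!: continuous_intros\<close>)
next
  fix s t assume "(0::real) \<le> s" "s \<le> t" "\<bar>f (T + s)\<bar> = \<infinity>"
  then show "f (T + t) = f (T + s)"
    using absorbing_path_absorbed[OF assms(1), of "T + s" "T + t"] assms by simp
qed

lemma absorbing_path_stop:
  assumes "absorbing_path f" "0 \<le> T"
  shows "absorbing_path (\<lambda>t. f (min t T))"
  unfolding absorbing_path_def
proof (intro conjI allI impI)
  show "continuous_on {0..} (\<lambda>t. f (min t T))"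
    by (rule continuous_on_compose2[OF absorbing_path_continuous[OF assms(1)]])
      (use assms in \<open>auto intro!: continuous_intros\<close>)
next
  fix s t assume "(0::real) \<le> s" "s \<le> t" "\<bar>f (min s T)\<bar> = \<infinity>"
  then show "f (min t T) = f (min s T)"
    using absorbing_path_absorbed[OF assms(1), of "min s T" "min t T"] assms by auto
qed

lemma closure_rational_unit_interval: "closure (\<rat> \<inter> {0..1::real}) = {0..1}"
proof
  show "closure (\<rat> \<inter> {0..1::real}) \<subseteq> {0..1}"
    by (rule closure_minimal) auto
  have "{0..1::real} = closure {0<..<1}" by simp
  also have "\<dots> = closure ({0<..<1} \<inter> \<rat>)"
    by (rule closure_open_Int_superset[symmetric]) (auto simp: Rats_closure_real)
  also have "\<dots> \<subseteq> closure (\<rat> \<inter> {0..1})"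
    by (rule closure_mono) auto
  finally show "{0..1::real} \<subseteq> closure (\<rat> \<inter> {0..1})" .
qed

lemma image_rational_times_subset:
  fixes f :: "real \<Rightarrow> ereal"
  assumes f: "continuous_on {0..} f" and t: "0 \<le> t" and C: "closed C"
    and sub: "\<And>u. u \<in> \<rat> \<inter> {0..1} \<Longrightarrow> f (t * u) \<in> C"
    and s: "s \<in> {0..t}"
  shows "f s \<in> C"
proof -
  have "continuous_on (closure (\<rat> \<inter> {0..1})) (\<lambda>u. f (t * u))"
    unfolding closure_rational_unit_interval
    by (rule continuous_on_compose2[OF f]) (use t in \<open>auto intro!: continuous_intros\<close>)
  then have "(\<lambda>u. f (t * u)) ` closure (\<rat> \<inter> {0..1}) \<subseteq> C"
    by (rule image_closure_subset) (use C sub in auto)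
  then have *: "f (t * u) \<in> C" if "0 \<le> u" "u \<le> 1" for u
    using that unfolding closure_rational_unit_interval by auto
  show ?thesis
  proof (cases "t = 0")
    case True then show ?thesis using *[of 0] s by auto
  next
    case False
    then have "f (t * (s / t)) \<in> C" using s t by (intro *) (auto simp: field_simps)
    then show ?thesis using False by simp
  qed
qed

text \<open>
  The grid of times \<open>t * u\<close>, with \<open>u\<close> a rational of the unit interval, is dense in \<open>{0..t}\<close> and
  contains both end points for every real \<open>t\<close>, rational or not. So the supremum over it involves
  countably many coordinates, none of them later than \<open>t\<close>.
\<close>

lemma SUP_rational_times:
  fixes f :: "real \<Rightarrow> ereal"
  assumes f: "continuous_on {0..} f" and t: "0 \<le> t"
  shows "(SUP u\<in>\<rat> \<inter> {0..1}. f (t * u)) = (SUP s\<in>{0..t}. f s)"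
proof (rule antisym)
  show "(SUP u\<in>\<rat> \<inter> {0..1}. f (t * u)) \<le> (SUP s\<in>{0..t}. f s)"
    by (rule SUP_least, rule SUP_upper) (use t in \<open>auto simp: mult_left_le\<close>)
  have "f s \<in> {..(SUP u\<in>\<rat> \<inter> {0..1}. f (t * u))}" if "s \<in> {0..t}" for s
    by (rule image_rational_times_subset[OF f t _ _ that]) (auto intro: SUP_upper2)
  then show "(SUP s\<in>{0..t}. f s) \<le> (SUP u\<in>\<rat> \<inter> {0..1}. f (t * u))"
    by (auto intro: SUP_least)
qed

lemma INF_rational_times:
  fixes f :: "real \<Rightarrow> ereal"
  assumes f: "continuous_on {0..} f" and t: "0 \<le> t"
  shows "(INF u\<in>\<rat> \<inter> {0..1}. f (t * u)) = (INF s\<in>{0..t}. f s)"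
proof (rule antisym)
  show "(INF s\<in>{0..t}. f s) \<le> (INF u\<in>\<rat> \<inter> {0..1}. f (t * u))"
    by (rule INF_greatest, rule INF_lower) (use t in \<open>auto simp: mult_left_le\<close>)
  have "f s \<in> {(INF u\<in>\<rat> \<inter> {0..1}. f (t * u))..}" if "s \<in> {0..t}" for s
    by (rule image_rational_times_subset[OF f t _ _ that]) (auto intro: INF_lower2)
  then show "(INF u\<in>\<rat> \<inter> {0..1}. f (t * u)) \<le> (INF s\<in>{0..t}. f s)"
    by (auto intro: INF_greatest)
qed

lemma running_max_real: "running_max X (ereal t) \<omega> = (SUP s\<in>{0..t}. X s \<omega>)"
proof -
  have "{s. 0 \<le> s \<and> ereal s \<le> ereal t} = {0..t}" by auto
  then show ?thesis by (simp add: running_max_def)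
qed

lemma running_max_upper: "0 \<le> s \<Longrightarrow> s \<le> t \<Longrightarrow> X s \<omega> \<le> running_max X (ereal t) \<omega>"
  unfolding running_max_real by (rule SUP_upper) simp

lemma running_max_mono: "s \<le> t \<Longrightarrow> running_max X (ereal s) \<omega> \<le> running_max X (ereal t) \<omega>"
  unfolding running_max_real by (rule SUP_subset_mono) auto

lemma running_max_attained:
  assumes "continuous_on {0..} (\<lambda>t. X t \<omega>)" "0 \<le> t"
  obtains r where "0 \<le> r" "r \<le> t" "running_max X (ereal t) \<omega> = X r \<omega>"
proof -
  have "continuous_on {0..t} (\<lambda>t. X t \<omega>)"
    by (rule continuous_on_subset[OF assms(1)]) auto
  then obtain r where r: "r \<in> {0..t}" "\<forall>s\<in>{0..t}. X s \<omega> \<le> X r \<omega>"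
    using continuous_attains_sup[of "{0..t}" "\<lambda>t. X t \<omega>"] assms(2) by auto
  then have "running_max X (ereal t) \<omega> = X r \<omega>"
    unfolding running_max_real by (intro antisym SUP_least SUP_upper) auto
  with r that show thesis by auto
qed

text \<open>
  The image of \<open>{0..t}\<close> is compact and connected, hence the closed interval between its extrema. Whether
  a level has been visited is therefore decided by the two countable extrema, with no approximation
  of the level by nearby values.
\<close>

lemma level_visited_iff_extrema:
  fixes f :: "real \<Rightarrow> ereal"
  assumes f: "continuous_on {0..} f" and t: "0 \<le> t"
  shows "(\<exists>s\<in>{0..t}. f s = y) \<longleftrightarrow>
     (INF u\<in>\<rat> \<inter> {0..1}. f (t * u)) \<le> y \<and> y \<le> (SUP u\<in>\<rat> \<inter> {0..1}. f (t * u))"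
  unfolding SUP_rational_times[OF f t] INF_rational_times[OF f t]
proof
  assume "\<exists>s\<in>{0..t}. f s = y"
  then show "(INF s\<in>{0..t}. f s) \<le> y \<and> y \<le> (SUP s\<in>{0..t}. f s)"
    by (auto intro: INF_lower2 SUP_upper2)
next
  assume y: "(INF s\<in>{0..t}. f s) \<le> y \<and> y \<le> (SUP s\<in>{0..t}. f s)"
  have c: "continuous_on {0..t} f" by (rule continuous_on_subset[OF f]) auto
  obtain a where a: "a \<in> {0..t}" "\<forall>s\<in>{0..t}. f a \<le> f s"
    using continuous_attains_inf[OF _ _ c] t by auto
  obtain b where b: "b \<in> {0..t}" "\<forall>s\<in>{0..t}. f s \<le> f b"
    using continuous_attains_sup[OF _ _ c] t by auto
  have "f a \<le> y" using y a by (auto intro: order_trans[OF INF_greatest])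
  moreover have "y \<le> f b" using y b by (auto intro: order_trans[OF _ SUP_least])
  moreover have "connected (f ` {0..t})" by (rule connected_continuous_image[OF c]) simp
  ultimately have "y \<in> f ` {0..t}"
    using connected_contains_Icc[of "f ` {0..t}" "f a" "f b"] a b by auto
  then show "\<exists>s\<in>{0..t}. f s = y" by auto
qed

lemma le_hitting_time_iff:
  "ereal s \<le> hitting_time X \<eta> \<omega> \<longleftrightarrow> (\<forall>r. 0 \<le> r \<and> r < s \<longrightarrow> X r \<omega> \<noteq> ereal \<eta>)"
  unfolding hitting_time_def le_Inf_iff by force

lemma hitting_time_nonneg: "0 \<le> hitting_time X \<eta> \<omega>"
  unfolding zero_ereal_def le_hitting_time_iff by auto

lemma hitting_time_le: "0 \<le> t \<Longrightarrow> X t \<omega> = ereal \<eta> \<Longrightarrow> hitting_time X \<eta> \<omega> \<le> ereal t"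
  unfolding hitting_time_def by (auto intro: Inf_lower)

lemma hitting_time_attained:
  assumes c: "continuous_on {0..} (\<lambda>t. X t \<omega>)" and fin: "hitting_time X \<eta> \<omega> < \<infinity>"
  obtains T where "hitting_time X \<eta> \<omega> = ereal T" "0 \<le> T" "X T \<omega> = ereal \<eta>"
    "\<And>s. 0 \<le> s \<Longrightarrow> s < T \<Longrightarrow> X s \<omega> \<noteq> ereal \<eta>"
proof -
  obtain t where t: "0 \<le> t" "X t \<omega> = ereal \<eta>"
    using fin unfolding hitting_time_def Inf_less_iff by auto
  let ?K = "{0..t} \<inter> (\<lambda>t. X t \<omega>) -` {ereal \<eta>}"
  have "continuous_on {0..t} (\<lambda>t. X t \<omega>)" by (rule continuous_on_subset[OF c]) auto
  then have "closed ?K" by (intro continuous_closed_preimage) auto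
  then have "compact ?K" by (metis compact_Icc compact_Int_closed inf_left_idem)
  moreover have "?K \<noteq> {}" using t by auto
  ultimately obtain T where T: "T \<in> ?K" "\<And>s. s \<in> ?K \<Longrightarrow> T \<le> s"
    using compact_attains_inf[of ?K] by blast
  have "X s \<omega> \<noteq> ereal \<eta>" if "0 \<le> s" "s < T" for s
    using T(1) T(2)[of s] that by auto
  moreover have "hitting_time X \<eta> \<omega> = ereal T"
    using T calculation by (intro antisym) (auto simp: le_hitting_time_iff intro: hitting_time_le)
  ultimately show thesis using T that by auto
qed

lemma hitting_time_le_iff:
  assumes "continuous_on {0..} (\<lambda>t. X t \<omega>)"
  shows "hitting_time X \<eta> \<omega> \<le> ereal t \<longleftrightarrow> (\<exists>s\<in>{0..t}. X s \<omega> = ereal \<eta>)"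
proof
  assume *: "hitting_time X \<eta> \<omega> \<le> ereal t"
  then have "hitting_time X \<eta> \<omega> < \<infinity>" by (auto intro: order.strict_trans1)
  from hitting_time_attained[OF assms this] * show "\<exists>s\<in>{0..t}. X s \<omega> = ereal \<eta>"
    by (metis atLeastAtMost_iff ereal_less_eq(3))
next
  assume "\<exists>s\<in>{0..t}. X s \<omega> = ereal \<eta>"
  then show "hitting_time X \<eta> \<omega> \<le> ereal t"
    by (auto intro: order_trans[OF hitting_time_le])
qed

lemma before_hitting_time_less:
  assumes c: "continuous_on {0..} (\<lambda>t. X t \<omega>)" and x: "X 0 \<omega> \<le> ereal \<eta>"
    and s: "0 \<le> s" "ereal s < hitting_time X \<eta> \<omega>"
  shows "X s \<omega> < ereal \<eta>"
proof (rule ccontr)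
  assume "\<not> ?thesis"
  then have "ereal \<eta> \<le> X s \<omega>" by simp
  moreover have "connected ((\<lambda>t. X t \<omega>) ` {0..s})"
    by (rule connected_continuous_image[OF continuous_on_subset[OF c]]) auto
  ultimately have "ereal \<eta> \<in> (\<lambda>t. X t \<omega>) ` {0..s}"
    using connected_contains_Icc[of "(\<lambda>t. X t \<omega>) ` {0..s}" "X 0 \<omega>" "X s \<omega>"] x s by auto
  then have "hitting_time X \<eta> \<omega> \<le> ereal s"
    unfolding hitting_time_le_iff[of X \<omega>, OF c] by auto
  with s show False by simp
qed

lemma before_hitting_time_greater:
  assumes c: "continuous_on {0..} (\<lambda>t. X t \<omega>)" and x: "X 0 \<omega> \<ge> ereal \<eta>"
    and s: "0 \<le> s" "ereal s < hitting_time X \<eta> \<omega>"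
  shows "X s \<omega> > ereal \<eta>"
proof (rule ccontr)
  assume "\<not> ?thesis"
  then have "ereal \<eta> \<ge> X s \<omega>" by simp
  moreover have "connected ((\<lambda>t. X t \<omega>) ` {0..s})"
    by (rule connected_continuous_image[OF continuous_on_subset[OF c]]) auto
  ultimately have "ereal \<eta> \<in> (\<lambda>t. X t \<omega>) ` {0..s}"
    using connected_contains_Icc[of "(\<lambda>t. X t \<omega>) ` {0..s}" "X s \<omega>" "X 0 \<omega>"] x s by auto
  then have "hitting_time X \<eta> \<omega> \<le> ereal s"
    unfolding hitting_time_le_iff[of X \<omega>, OF c] by auto
  with s show False by simp
qed

lemma max_drawdown_upper:
  "0 \<le> s \<Longrightarrow> ereal s \<le> t \<Longrightarrow> running_max X (ereal s) \<omega> - X s \<omega> \<le> max_drawdown X t \<omega>"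
  unfolding max_drawdown_def by (rule SUP_upper) simp

lemma max_drawdown_nonneg:
  assumes "0 \<le> t"
  shows "0 \<le> max_drawdown X t \<omega>"
proof -
  have "0 \<le> running_max X (ereal 0) \<omega> - X 0 \<omega>"
    unfolding running_max_real by (cases "X 0 \<omega>") auto
  also have "\<dots> \<le> max_drawdown X t \<omega>"
    using assms by (intro max_drawdown_upper) (auto simp: zero_ereal_def)
  finally show ?thesis .
qed

text \<open>
  Countable counterparts of ``the level has been visited by time \<open>t\<close>'' and of the drawdown at the
  hitting time. They involve countably many coordinates and are therefore measurable on the product
  space \<open>\<Pi>\<^sub>M t\<in>{0..}. borel\<close>, where the suprema over all times are not. The value \<open>0\<close> for times
  \<open>q\<close> after the visit does not change the supremum, because the term at \<open>q = 0\<close> is nonnegative.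
\<close>

definition hit_by :: "(real \<Rightarrow> 'w \<Rightarrow> ereal) \<Rightarrow> real \<Rightarrow> real \<Rightarrow> 'w \<Rightarrow> bool" where
  "hit_by X \<eta> t \<omega> \<longleftrightarrow> (INF u\<in>\<rat> \<inter> {0..1}. X (t * u) \<omega>) \<le> ereal \<eta> \<and>
     ereal \<eta> \<le> (SUP u\<in>\<rat> \<inter> {0..1}. X (t * u) \<omega>)"

definition rational_drawdown :: "(real \<Rightarrow> 'w \<Rightarrow> ereal) \<Rightarrow> real \<Rightarrow> 'w \<Rightarrow> ereal" where
  "rational_drawdown X \<eta> \<omega> = (SUP q\<in>\<rat> \<inter> {0..}.
     if \<exists>r\<in>\<rat> \<inter> {0..<q}. hit_by X \<eta> r \<omega> then 0
     else (SUP u\<in>\<rat> \<inter> {0..1}. X (q * u) \<omega>) - X q \<omega>)"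

lemma hit_by_eq:
  assumes "continuous_on {0..} (\<lambda>t. X t \<omega>)" "0 \<le> t"
  shows "hit_by X \<eta> t \<omega> \<longleftrightarrow> hitting_time X \<eta> \<omega> \<le> ereal t"
  unfolding hit_by_def hitting_time_le_iff[of X \<omega>, OF assms(1)]
  by (subst level_visited_iff_extrema) (use assms in auto)

lemma rational_before_hitting:
  assumes c: "continuous_on {0..} (\<lambda>t. X t \<omega>)" and q: "0 \<le> q"
  shows "(\<exists>r\<in>\<rat> \<inter> {0..<q}. hit_by X \<eta> r \<omega>) \<longleftrightarrow> hitting_time X \<eta> \<omega> < ereal q"
proof
  assume "\<exists>r\<in>\<rat> \<inter> {0..<q}. hit_by X \<eta> r \<omega>"
  then obtain r where "0 \<le> r" "r < q" "hit_by X \<eta> r \<omega>" by auto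
  then show "hitting_time X \<eta> \<omega> < ereal q"
    using hit_by_eq[of X \<omega>, OF c] by (auto intro: order.strict_trans1)
next
  assume *: "hitting_time X \<eta> \<omega> < ereal q"
  then have "hitting_time X \<eta> \<omega> < \<infinity>" by (auto intro: order.strict_trans)
  then obtain T where T: "hitting_time X \<eta> \<omega> = ereal T" "0 \<le> T"
    by (rule hitting_time_attained[of X \<omega>, OF c])
  then have "T < q" using * by simp
  then obtain r where "r \<in> \<rat>" "T < r" "r < q" using Rats_dense_in_real by blast
  then show "\<exists>r\<in>\<rat> \<inter> {0..<q}. hit_by X \<eta> r \<omega>"
    using hit_by_eq[of X \<omega>, OF c] T by (intro bexI[of _ r]) auto
qed

text \<open>
  A drawdown exceeding \<open>c \<ge> 0\<close> at a time \<open>s\<close> before the hitting time also occurs at a rational time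
  before it. If the value at \<open>s\<close> is infinite, the path is absorbed there and any slightly later time will
  do. Otherwise the path was finite up to \<open>s\<close>, its maximum is attained at some earlier \<open>r < s\<close>, and
  by continuity any time shortly before \<open>s\<close> will do; approximating from the left does not leave the
  interval up to the hitting time even if \<open>s\<close> is that time.
\<close>

lemma max_drawdown_eq_rational:
  assumes p: "absorbing_path (\<lambda>t. X t \<omega>)"
  shows "hit_drawdown X \<eta> \<omega> = rational_drawdown X \<eta> \<omega>"
proof -
  note c = absorbing_path_continuous[OF p]
  let ?H = "hitting_time X \<eta> \<omega>" and ?M = "\<lambda>t. running_max X (ereal t) \<omega>"
  have rd: "rational_drawdown X \<eta> \<omega> =
      (SUP q\<in>\<rat> \<inter> {0..}. if ?H < ereal q then 0 else ?M q - X q \<omega>)"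
    unfolding rational_drawdown_def
    by (intro SUP_cong refl) (simp add: rational_before_hitting[of X \<omega>, OF c] running_max_real
        SUP_rational_times[OF c])
  have up: "?M q - X q \<omega> \<le> rational_drawdown X \<eta> \<omega>" if "q \<in> \<rat>" "0 \<le> q" "ereal q \<le> ?H" for q
    unfolding rd using that by (intro SUP_upper2[of q]) auto
  have nonneg: "0 \<le> rational_drawdown X \<eta> \<omega>"
  proof -
    have "0 \<le> ?M 0 - X 0 \<omega>" unfolding running_max_real by (cases "X 0 \<omega>") auto
    also have "\<dots> \<le> rational_drawdown X \<eta> \<omega>"
      using hitting_time_nonneg[of X \<eta> \<omega>] by (intro up) (auto simp: zero_ereal_def)
    finally show ?thesis .
  qed
  show ?thesis
  proof (rule antisym)
    show "rational_drawdown X \<eta> \<omega> \<le> max_drawdown X ?H \<omega>"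
      unfolding rd by (rule SUP_least)
        (auto intro: max_drawdown_upper max_drawdown_nonneg hitting_time_nonneg)
    have "?M s - X s \<omega> \<le> rational_drawdown X \<eta> \<omega>" if s: "0 \<le> s" "ereal s \<le> ?H" for s
    proof (rule ccontr)
      assume "\<not> ?thesis"
      then have less: "rational_drawdown X \<eta> \<omega> < ?M s - X s \<omega>" by simp
      show False
      proof (cases "\<bar>X s \<omega>\<bar> = \<infinity>")
        case True
        have "ereal s < ?H"
        proof (rule ccontr)
          assume "\<not> ?thesis"
          then have "?H = ereal s" using s by auto
          then have "\<exists>r\<in>{0..s}. X r \<omega> = ereal \<eta>" "\<And>r. 0 \<le> r \<and> r < s \<longrightarrow> X r \<omega> \<noteq> ereal \<eta>"
            using hitting_time_le_iff[of X \<omega>, OF c, of \<eta> s] le_hitting_time_iff[of s X \<eta> \<omega>]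
            by auto
          then have "X s \<omega> = ereal \<eta>" by (metis atLeastAtMost_iff order_le_less)
          then show False using True by simp
        qed
        then obtain z where z: "ereal s < ereal z" "ereal z < ?H"
          using ereal_dense2 by blast
        then obtain q where q: "q \<in> \<rat>" "s < q" "q < z"
          using Rats_dense_in_real[of s z] by auto
        have "?M s - X s \<omega> \<le> ?M q - X q \<omega>"
          using q s running_max_mono[of s q X \<omega>] absorbing_path_absorbed[OF p, of s q] True
          by (intro ereal_minus_mono) auto
        also have "\<dots> \<le> rational_drawdown X \<eta> \<omega>"
          using q s order.strict_trans[of "ereal q" "ereal z" ?H] z by (intro up) auto
        finally show False using less by simp
      next
        case False
        obtain r where r: "0 \<le> r" "r \<le> s" "?M s = X r \<omega>"
          by (rule running_max_attained[of X \<omega>, OF c s(1)])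
        have fr: "\<bar>X r \<omega>\<bar> \<noteq> \<infinity>"
          using absorbing_path_absorbed[OF p r(1,2)] False by auto
        define d where "d = rational_drawdown X \<eta> \<omega>"
        have d: "0 \<le> d" "d < X r \<omega> - X s \<omega>" using less nonneg r by (auto simp: d_def)
        then have d': "X s \<omega> < X r \<omega> - d" "\<bar>d\<bar> \<noteq> \<infinity>"
          using fr False by (cases d; cases "X r \<omega>"; cases "X s \<omega>"; auto)+
        have "r \<noteq> s" using d fr by (cases "X r \<omega>") auto
        then have rs: "r < s" using r by simp
        have "((\<lambda>t. X t \<omega>) \<longlongrightarrow> X s \<omega>) (at s within {0..})"
          using c s by (auto simp: continuous_on_def)
        from order_tendstoD(2)[OF this d'(1)]
        obtain e where e: "e > 0" "\<And>t. 0 \<le> t \<Longrightarrow> t \<noteq> s \<Longrightarrow> dist t s < e \<Longrightarrow> X t \<omega> < X r \<omega> - d"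
          unfolding eventually_at by auto
        obtain q where q: "q \<in> \<rat>" "max r (s - e) < q" "q < s"
          using Rats_dense_in_real[of "max r (s - e)" s] rs e by auto
        have "X q \<omega> < X r \<omega> - d" using q r e by (auto simp: dist_real_def)
        then have "d < X r \<omega> - X q \<omega>"
          using d'(2) fr by (cases d; cases "X r \<omega>"; cases "X q \<omega>") auto
        also have "\<dots> \<le> ?M q - X q \<omega>"
          using q r by (intro ereal_minus_mono running_max_upper) auto
        also have "\<dots> \<le> d" unfolding d_def
          using q r s by (intro up) (auto intro: order_trans[of "ereal q" "ereal s"])
        finally show False by simp
      qed
    qed
    then show "max_drawdown X ?H \<omega> \<le> rational_drawdown X \<eta> \<omega>"
      unfolding max_drawdown_def by (intro SUP_least) auto
  qed
qed

lemma measurable_hit_by: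
  assumes "\<And>s. 0 \<le> s \<Longrightarrow> s \<le> t \<Longrightarrow> X s \<in> borel_measurable K" "0 \<le> t"
  shows "Measurable.pred K (hit_by X \<eta> t)"
proof -
  have c: "countable (\<rat> \<inter> {0..1::real})" by (rule countable_Int1[OF countable_rat])
  have [measurable]: "X (t * u) \<in> borel_measurable K" if "u \<in> \<rat> \<inter> {0..1}" for u
    using that assms(2) by (intro assms(1)) (simp_all add: mult_left_le)
  have [measurable]: "(\<lambda>\<omega>. INF u\<in>\<rat> \<inter> {0..1}. X (t * u) \<omega>) \<in> borel_measurable K"
    "(\<lambda>\<omega>. SUP u\<in>\<rat> \<inter> {0..1}. X (t * u) \<omega>) \<in> borel_measurable K"
    by (auto intro!: borel_measurable_INF[OF c] borel_measurable_SUP[OF c])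
  show ?thesis unfolding hit_by_def by measurable
qed

lemma measurable_rational_drawdown:
  assumes X: "\<And>t. 0 \<le> t \<Longrightarrow> X t \<in> borel_measurable K"
  shows "rational_drawdown X \<eta> \<in> borel_measurable K"
  unfolding rational_drawdown_def
proof (rule borel_measurable_SUP)
  show "countable (\<rat> \<inter> {0::real..})" by (rule countable_Int1[OF countable_rat])
  fix q :: real assume q: "q \<in> \<rat> \<inter> {0..}"
  have [measurable]: "Measurable.pred K (\<lambda>\<omega>. \<exists>r\<in>\<rat> \<inter> {0..<q}. hit_by X \<eta> r \<omega>)"
  proof -
    have "(\<Union>r\<in>\<rat> \<inter> {0..<q}. {\<omega>\<in>space K. hit_by X \<eta> r \<omega>}) \<in> sets K"
      by (intro sets.countable_UN' countable_Int1[OF countable_rat])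
        (auto intro!: measurable_hit_by X simp flip: pred_def)
    also have "(\<Union>r\<in>\<rat> \<inter> {0..<q}. {\<omega>\<in>space K. hit_by X \<eta> r \<omega>}) =
        {\<omega>\<in>space K. \<exists>r\<in>\<rat> \<inter> {0..<q}. hit_by X \<eta> r \<omega>}" by auto
    finally show ?thesis by (simp add: pred_def)
  qed
  have c: "countable (\<rat> \<inter> {0..1::real})" by (rule countable_Int1[OF countable_rat])
  have [measurable]: "(\<lambda>\<omega>. SUP u\<in>\<rat> \<inter> {0..1}. X (q * u) \<omega>) \<in> borel_measurable K"
    by (rule borel_measurable_SUP[OF c]) (use q in \<open>auto intro!: X\<close>)
  have [measurable]: "X q \<in> borel_measurable K" using X q by auto
  show "(\<lambda>\<omega>. if \<exists>r\<in>\<rat> \<inter> {0..<q}. hit_by X \<eta> r \<omega> then 0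
     else (SUP u\<in>\<rat> \<inter> {0..1}. X (q * u) \<omega>) - X q \<omega>) \<in> borel_measurable K"
    by measurable
qed

lemma rational_drawdown_cong:
  assumes "\<And>t. 0 \<le> t \<Longrightarrow> X t \<omega> = Y t \<omega>'"
  shows "rational_drawdown X \<eta> \<omega> = rational_drawdown Y \<eta> \<omega>'"
proof -
  have *: "X (q * u) \<omega> = Y (q * u) \<omega>'" if "0 \<le> q" "u \<in> \<rat> \<inter> {0..1}" for q u
    using that by (intro assms) simp
  have h: "hit_by X \<eta> r \<omega> = hit_by Y \<eta> r \<omega>'" if "0 \<le> r" for r
  proof -
    have "(SUP u\<in>\<rat> \<inter> {0..1}. X (r * u) \<omega>) = (SUP u\<in>\<rat> \<inter> {0..1}. Y (r * u) \<omega>')"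
      "(INF u\<in>\<rat> \<inter> {0..1}. X (r * u) \<omega>) = (INF u\<in>\<rat> \<inter> {0..1}. Y (r * u) \<omega>')"
      using *[OF that] by (auto intro!: SUP_cong INF_cong)
    then show ?thesis unfolding hit_by_def by simp
  qed
  show ?thesis unfolding rational_drawdown_def
    by (intro SUP_cong refl if_cong arg_cong2[of _ _ _ _ "(-)"] bex_cong h) (auto intro!: * assms)
qed

text \<open>
  Up to its hitting time a path cannot be told from the path frozen at a later time \<open>T\<close>. This turns the
  countable expression for the drawdown into one that involves coordinates up to \<open>T\<close> only.
\<close>

lemma drawdown_stopped:
  assumes c: "continuous_on {0..} (\<lambda>t. X t \<omega>)" and H: "hitting_time X \<eta> \<omega> \<le> ereal T"
  defines "Y \<equiv> \<lambda>t. X (min t T)"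
  shows "hit_drawdown Y \<eta> \<omega> = hit_drawdown X \<eta> \<omega>"
proof -
  have "hitting_time X \<eta> \<omega> < \<infinity>" using H by (auto intro: order.strict_trans1)
  then obtain h where h: "hitting_time X \<eta> \<omega> = ereal h" "0 \<le> h" "X h \<omega> = ereal \<eta>"
    "\<And>s. 0 \<le> s \<Longrightarrow> s < h \<Longrightarrow> X s \<omega> \<noteq> ereal \<eta>"
    using hitting_time_attained[of X \<omega>, OF c] by blast
  then have hT: "h \<le> T" using H by simp
  have "hitting_time Y \<eta> \<omega> = ereal h"
    using h hT by (intro antisym hitting_time_le) (auto simp: Y_def le_hitting_time_iff)
  moreover have "running_max Y (ereal s) \<omega> = running_max X (ereal s) \<omega>" if "s \<le> h" for s
    unfolding running_max_real Y_def using that hT by (intro SUP_cong) auto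
  ultimately show ?thesis
    unfolding max_drawdown_def h(1) using hT by (intro SUP_cong) (auto simp: Y_def)
qed

section \<open>Splitting a path at a hitting time\<close>

text \<open>
  When the path reaches \<open>y\<close> from below it is at its running maximum, so from then on its running
  maximum is that of the shifted path, and every drawdown of the path happens either before
  that time or within the shifted path.
\<close>

lemma max_drawdown_after_hitting:
  assumes c: "continuous_on {0..} (\<lambda>t. X t \<omega>)" and x: "X 0 \<omega> \<le> ereal y"
    and T: "hitting_time X y \<omega> = ereal T" and yz: "y \<le> z"
  defines "Y \<equiv> \<lambda>t. X (T + t)"
  shows "hit_drawdown X z \<omega> =
    max (hit_drawdown X y \<omega>) (hit_drawdown Y z \<omega>)"
proof -
  obtain T' where "hitting_time X y \<omega> = ereal T'" "0 \<le> T'" "X T' \<omega> = ereal y"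
    by (rule hitting_time_attained[of X \<omega> y, OF c]) (use T in simp_all)
  then have XT: "0 \<le> T" "X T \<omega> = ereal y" using T by simp_all
  have below: "X s \<omega> < ereal y" if "0 \<le> s" "s < T" for s
    using before_hitting_time_less[of X \<omega>, OF c x] that T by simp
  have le: "X s \<omega> \<le> ereal y" if "0 \<le> s" "s \<le> T" for s
    using below[of s] XT that by (cases "s = T") auto
  have Tz: "ereal T \<le> hitting_time X z \<omega>"
    unfolding le_hitting_time_iff
  proof safe
    fix r assume "0 \<le> r" "r < T" "X r \<omega> = ereal z"
    then show False using below[of r] yz by simp
  qed
  have iff: "ereal (T + s) \<le> hitting_time X z \<omega> \<longleftrightarrow> ereal s \<le> hitting_time Y z \<omega>"
    if "0 \<le> s" for s
    unfolding le_hitting_time_iff Y_def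
  proof safe
    fix r assume *: "\<forall>r. 0 \<le> r \<and> r < T + s \<longrightarrow> X r \<omega> \<noteq> ereal z" "0 \<le> r" "r < s"
      "X (T + r) \<omega> = ereal z"
    then show False using *(1)[rule_format, of "T + r"] XT by simp
  next
    fix r assume *: "\<forall>r. 0 \<le> r \<and> r < s \<longrightarrow> X (T + r) \<omega> \<noteq> ereal z" "0 \<le> r" "r < T + s"
      "X r \<omega> = ereal z"
    then have "\<not> r < T" using below[of r] yz by auto
    then show False using * *(1)[rule_format, of "r - T"] by simp
  qed
  have rm: "running_max X (ereal (T + s)) \<omega> = running_max Y (ereal s) \<omega>" if "0 \<le> s" for s
    unfolding running_max_real
  proof (rule antisym)
    have "X r \<omega> \<le> (SUP r\<in>{0..s}. Y r \<omega>)" if "r \<in> {0..T + s}" for r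
    proof (cases "r \<le> T")
      case True
      then have "X r \<omega> \<le> Y 0 \<omega>" using le[of r] XT that by (simp add: Y_def)
      also have "\<dots> \<le> (SUP r\<in>{0..s}. Y r \<omega>)" using \<open>0 \<le> s\<close> by (intro SUP_upper) simp
      finally show ?thesis .
    next
      case False
      then show ?thesis using that by (intro SUP_upper2[of "r - T"]) (auto simp: Y_def)
    qed
    then show "(SUP r\<in>{0..T + s}. X r \<omega>) \<le> (SUP r\<in>{0..s}. Y r \<omega>)" by (auto intro: SUP_least)
    show "(SUP r\<in>{0..s}. Y r \<omega>) \<le> (SUP r\<in>{0..T + s}. X r \<omega>)"
      unfolding Y_def using XT by (intro SUP_least SUP_upper) auto
  qed
  have "{s. 0 \<le> s \<and> ereal s \<le> hitting_time X z \<omega>} =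
      {s. 0 \<le> s \<and> ereal s \<le> hitting_time X y \<omega>} \<union>
      (+) T ` {s. 0 \<le> s \<and> ereal s \<le> hitting_time Y z \<omega>}" (is "?A = ?B \<union> ?C")
  proof safe
    fix s assume s: "0 \<le> s" "ereal s \<le> hitting_time X z \<omega>" "s \<notin> ?C"
    have "\<not> T \<le> s"
    proof
      assume "T \<le> s"
      then have "s - T \<in> {s. 0 \<le> s \<and> ereal s \<le> hitting_time Y z \<omega>}"
        using s iff[of "s - T"] by simp
      from imageI[OF this, of "(+) T"] s show False by simp
    qed
    then show "ereal s \<le> hitting_time X y \<omega>" using T by simp
  next
    fix s assume "ereal s \<le> hitting_time X y \<omega>"
    then show "ereal s \<le> hitting_time X z \<omega>" using Tz T order_trans[of "ereal s" "ereal T"] by simp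
  qed (use XT iff in auto)
  then have "hit_drawdown X z \<omega> =
    sup (hit_drawdown X y \<omega>)
     (SUP s\<in>?C. running_max X (ereal s) \<omega> - X s \<omega>)"
    unfolding max_drawdown_def by (simp only: SUP_union)
  also have "(SUP s\<in>?C. running_max X (ereal s) \<omega> - X s \<omega>) =
      hit_drawdown Y z \<omega>"
    unfolding max_drawdown_def image_image
    by (intro SUP_cong refl arg_cong2[of _ _ _ _ "(-)"]) (auto simp: rm, auto simp: Y_def)
  finally show ?thesis by (simp add: sup_max)
qed

text \<open>
  A path started between \<open>v - \<delta>\<close> and \<open>v\<close> that reaches \<open>v\<close> before \<open>v - \<delta>\<close> stays in \<open>{v - \<delta>..v}\<close> until then.
\<close>

lemma no_large_drawdown:
  assumes c: "continuous_on {0..} (\<lambda>t. X t \<omega>)"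
    and x: "X 0 \<omega> = ereal u" and uv: "v - \<delta> < u" "u \<le> v"
    and less: "hitting_time X v \<omega> < \<infinity>" "hitting_time X v \<omega> \<le> hitting_time X (v - \<delta>) \<omega>"
  shows "hit_drawdown X v \<omega> \<le> ereal \<delta>"
proof -
  obtain T where T: "hitting_time X v \<omega> = ereal T" "0 \<le> T" "X T \<omega> = ereal v"
    using hitting_time_attained[of X \<omega>, OF c less(1)] by metis
  have le: "X s \<omega> \<le> ereal v" if "0 \<le> s" "s \<le> T" for s
    using before_hitting_time_less[of X \<omega> v s, OF c] that T x uv by (cases "s = T") auto
  have ge: "X s \<omega> \<ge> ereal (v - \<delta>)" if "0 \<le> s" "s \<le> T" for s
  proof (cases "s = T")
    case False
    then have "ereal s < ereal T" using that by simp
    also have "\<dots> \<le> hitting_time X (v - \<delta>) \<omega>" using less T by simp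
    finally show ?thesis
      using before_hitting_time_greater[of X \<omega> "v - \<delta>" s, OF c] that x uv by simp
  qed (use T uv in auto)
  have "running_max X (ereal s) \<omega> - X s \<omega> \<le> ereal v - ereal (v - \<delta>)" if "0 \<le> s" "s \<le> T" for s
    using that by (intro ereal_minus_mono ge) (auto simp: running_max_real intro!: SUP_least le)
  then show ?thesis unfolding max_drawdown_def T(1) by (intro SUP_least) auto
qed

lemma large_drawdown:
  assumes c: "continuous_on {0..} (\<lambda>t. X t \<omega>)" and x: "X 0 \<omega> = ereal u"
    and less: "hitting_time X (u - d) \<omega> < hitting_time X v \<omega>"
  shows "ereal d \<le> hit_drawdown X v \<omega>"
proof -
  have "hitting_time X (u - d) \<omega> < \<infinity>" using less by (auto intro: order.strict_trans2)
  then obtain T where T: "hitting_time X (u - d) \<omega> = ereal T" "0 \<le> T" "X T \<omega> = ereal (u - d)"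
    using hitting_time_attained[of X \<omega>, OF c] by metis
  have "ereal u - ereal (u - d) \<le> running_max X (ereal T) \<omega> - X T \<omega>"
    using running_max_upper[of 0 T X \<omega>] T x by (intro ereal_minus_mono) auto
  also have "\<dots> \<le> hit_drawdown X v \<omega>"
    using T less by (intro max_drawdown_upper) auto
  finally show ?thesis by simp
qed

section \<open>The strong Markov property at a hitting time\<close>

lemma space_history: "space (history \<Omega> X t) = \<Omega>"
  by (simp add: history_def space_measure_of_conv)

lemma measurable_history:
  assumes "0 \<le> s" "ereal s \<le> t"
  shows "X s \<in> borel_measurable (history \<Omega> X t)"
proof (rule measurableI)
  fix B :: "ereal set" assume "B \<in> sets borel"
  then show "X s -` B \<inter> space (history \<Omega> X t) \<in> sets (history \<Omega> X t)"
    unfolding space_history unfolding history_def using assms by (intro in_measure_of) auto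
qed simp

lemma history_mono: "t \<le> u \<Longrightarrow> sets (history \<Omega> X t) \<subseteq> sets (history \<Omega> X u)"
  unfolding history_def
  by (subst (1 2) sets_measure_of) (auto intro!: sigma_sets_mono' dest: order_trans)

lemma history_plus_generator: "(\<Inter>u\<in>insert \<infinity> {t<..}. sets (history \<Omega> X u)) \<subseteq> Pow \<Omega>"
proof
  fix A assume "A \<in> (\<Inter>u\<in>insert \<infinity> {t<..}. sets (history \<Omega> X u))"
  then have "A \<in> sets (history \<Omega> X \<infinity>)" by auto
  then show "A \<in> Pow \<Omega>" using sets.sets_into_space[of A "history \<Omega> X \<infinity>"] by (simp add: space_history)
qed

lemma history_subset_history_plus: "sets (history \<Omega> X t) \<subseteq> sets (history_plus \<Omega> X t)"
proof
  fix A assume A: "A \<in> sets (history \<Omega> X t)"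
  have "A \<in> sets (history \<Omega> X u)" if "u \<in> insert \<infinity> {t<..}" for u
    using A history_mono[of t u \<Omega> X] that by (cases "u = \<infinity>") (auto simp: less_imp_le)
  then show "A \<in> sets (history_plus \<Omega> X t)"
    unfolding history_plus_def by (intro in_measure_of history_plus_generator) auto
qed

lemma filtration_history_plus: "filtration \<Omega> (history_plus \<Omega> X)"
proof
  show "space (history_plus \<Omega> X t) = \<Omega>" for t
    by (simp add: history_plus_def space_measure_of_conv)
  show "sets (history_plus \<Omega> X t) \<le> sets (history_plus \<Omega> X u)" if "t \<le> u" for t u
    unfolding history_plus_def sets_measure_of[OF history_plus_generator]
  proof (rule sigma_sets_mono', rule INF_superset_mono)
    show "insert \<infinity> {u<..} \<subseteq> insert \<infinity> {t<..}" using that by auto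
  qed simp
qed

context regular_diffusion
begin

lemma space_P: "space (P x) = space N"
  by (rule sets_eq_imp_space_eq[OF sets_P])

lemma absorbing_path_X: "\<omega> \<in> space N \<Longrightarrow> absorbing_path (\<lambda>t. X t \<omega>)"
  unfolding absorbing_path_def by (intro conjI allI impI continuous_paths absorbed)

text \<open>
  The \<open>\<sigma>\<close>-algebra \<open>K\<close> is left open to cover both that of \<open>N\<close> and the history up to time \<open>t\<close>.
\<close>

lemma hitting_time_le_sets:
  assumes K: "space K = space N" "\<And>s. 0 \<le> s \<Longrightarrow> ereal s \<le> t \<Longrightarrow> X s \<in> borel_measurable K"
  shows "{\<omega>\<in>space N. hitting_time X \<eta> \<omega> \<le> t} \<in> sets K"
proof (cases "0 \<le> t")
  case False
  then have "{\<omega>\<in>space N. hitting_time X \<eta> \<omega> \<le> t} = {}"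
    using hitting_time_nonneg[of X \<eta>] by (auto dest: order_trans)
  then show ?thesis by (simp only: sets.empty_sets)
next
  case True
  show ?thesis
  proof (cases t)
    case (real r)
    then have "Measurable.pred K (hit_by X \<eta> r)"
      using True K(2) by (intro measurable_hit_by) auto
    moreover have "{\<omega>\<in>space N. hitting_time X \<eta> \<omega> \<le> t} = {\<omega>\<in>space K. hit_by X \<eta> r \<omega>}"
      using hit_by_eq[of X, OF continuous_paths, of _ r \<eta>] real True K(1) by auto
    ultimately show ?thesis by (simp add: pred_def)
  next
    case PInf
    have "{\<omega>\<in>space N. hitting_time X \<eta> \<omega> \<le> t} = space K" using PInf K by auto
    then show ?thesis by simp
  qed (use True in simp)
qed

lemma measurable_hitting_time: "hitting_time X \<eta> \<in> borel_measurable N"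
  by (rule borel_measurableI_le) (auto intro: hitting_time_le_sets measurable_X)

lemma stopping_time_hitting_time:
  "stopping_time (history_plus (space N) X) (hitting_time X \<eta>)"
proof
  interpret filtration "space N" "history_plus (space N) X" by (rule filtration_history_plus)
  fix t
  have "{\<omega>\<in>space N. hitting_time X \<eta> \<omega> \<le> t} \<in> sets (history (space N) X t)"
    by (intro hitting_time_le_sets measurable_history) (auto simp: space_history)
  then show "Measurable.pred (history_plus (space N) X t) (\<lambda>\<omega>. hitting_time X \<eta> \<omega> \<le> t)"
    using history_subset_history_plus unfolding pred_def space_F by auto
qed

lemma hit_drawdown_eq_rational:
  "\<omega> \<in> space N \<Longrightarrow> hit_drawdown X \<eta> \<omega> = rational_drawdown X \<eta> \<omega>"
  by (rule max_drawdown_eq_rational[of X, OF absorbing_path_X])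

lemma measurable_hit_drawdown: "hit_drawdown X \<eta> \<in> borel_measurable N"
  using measurable_rational_drawdown[of X N \<eta>, OF measurable_X]
  by (simp add: hit_drawdown_eq_rational cong: measurable_cong)

text \<open>
  The drawdown at the hitting time of \<open>y\<close> is known at that time: on the event that \<open>y\<close> is hit by time \<open>t\<close>
  it equals the countable expression for the path stopped at \<open>t\<close>, which belongs to the history at \<open>t\<close>.
\<close>

lemma hit_drawdown_pre_sigma:
  assumes B[measurable]: "B \<in> sets borel"
  shows "{\<omega>\<in>space N. X 0 \<omega> \<le> ereal y \<and> hit_drawdown X y \<omega> \<in> B} \<in>
    sets (filtration.pre_sigma (space N) (history_plus (space N) X) (hitting_time X y))"
    (is "?A \<in> _")
proof -
  interpret filtration "space N" "history_plus (space N) X" by (rule filtration_history_plus)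
  have "{\<omega>\<in>?A. hitting_time X y \<omega> \<le> t} \<in> sets (history (space N) X t)" for t
  proof (cases "0 \<le> t")
    case False
    then have "{\<omega>\<in>?A. hitting_time X y \<omega> \<le> t} = {}"
      using hitting_time_nonneg[of X y] by (auto dest: order_trans)
    then show ?thesis by (simp only: sets.empty_sets)
  next
    case True
    let ?K = "history (space N) X t"
    have [measurable]: "X 0 \<in> borel_measurable ?K"
      using True by (intro measurable_history) (auto simp: zero_ereal_def)
    have "\<exists>Y. (\<forall>\<omega>\<in>space N. hitting_time X y \<omega> \<le> t \<longrightarrow> hit_drawdown X y \<omega> = rational_drawdown Y y \<omega>)
       \<and> (\<forall>s\<ge>0. Y s \<in> borel_measurable ?K)"
    proof (cases t)
      case (real r)
      have "hit_drawdown X y \<omega> = rational_drawdown (\<lambda>s. X (min s r)) y \<omega>"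
        if "\<omega> \<in> space N" "hitting_time X y \<omega> \<le> t" for \<omega>
      proof -
        have "absorbing_path (\<lambda>s. X (min s r) \<omega>)"
          using absorbing_path_stop[OF absorbing_path_X[OF that(1)]] True real by simp
        then have "hit_drawdown (\<lambda>s. X (min s r)) y \<omega> = rational_drawdown (\<lambda>s. X (min s r)) y \<omega>"
          by (rule max_drawdown_eq_rational)
        then show ?thesis
          using drawdown_stopped[of X \<omega> y r, OF continuous_paths[OF that(1)]] that(2) real by simp
      qed
      moreover have "X (min s r) \<in> borel_measurable ?K" if "0 \<le> s" for s
        using that real True by (intro measurable_history) auto
      ultimately show ?thesis by (intro exI[of _ "\<lambda>s. X (min s r)"]) auto
    next
      case PInf
      then show ?thesis
        by (intro exI[of _ X]) (auto simp: hit_drawdown_eq_rational intro: measurable_history)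
    qed (use True in simp)
    then obtain Y where Y: "\<And>\<omega>. \<omega> \<in> space N \<Longrightarrow> hitting_time X y \<omega> \<le> t \<Longrightarrow>
        hit_drawdown X y \<omega> = rational_drawdown Y y \<omega>"
      and YK: "\<And>s. 0 \<le> s \<Longrightarrow> Y s \<in> borel_measurable ?K" by blast
    have [measurable]: "rational_drawdown Y y \<in> borel_measurable ?K"
      by (rule measurable_rational_drawdown[OF YK])
    have "{\<omega>\<in>space N. hitting_time X y \<omega> \<le> t} \<in> sets ?K"
      by (intro hitting_time_le_sets measurable_history) (auto simp: space_history)
    moreover have "{\<omega>\<in>space ?K. X 0 \<omega> \<le> ereal y \<and> rational_drawdown Y y \<omega> \<in> B} \<in> sets ?K"
      by measurable
    ultimately have "{\<omega>\<in>space N. hitting_time X y \<omega> \<le> t} \<inter>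
        {\<omega>\<in>space ?K. X 0 \<omega> \<le> ereal y \<and> rational_drawdown Y y \<omega> \<in> B} \<in> sets ?K"
      by (rule sets.Int)
    also have "{\<omega>\<in>space N. hitting_time X y \<omega> \<le> t} \<inter>
        {\<omega>\<in>space ?K. X 0 \<omega> \<le> ereal y \<and> rational_drawdown Y y \<omega> \<in> B} =
        {\<omega>\<in>?A. hitting_time X y \<omega> \<le> t}"
      using Y by (auto simp: space_history)
    finally show ?thesis .
  qed
  then show ?thesis
    using history_subset_history_plus by (intro sets_pre_sigmaI stopping_time_hitting_time) blast
qed

text \<open>
  The drawdown when \<open>z\<close> is hit is at most \<open>d\<close> if and only if both the drawdown when \<open>y\<close> is hit and that
  of the path after hitting \<open>y\<close> are. The first event belongs to the past of the stopping time
  \<open>hitting_time X y\<close>, and at that time the path is at \<open>y\<close>, so the law of the future does not depend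
  on the past and the probability factorises.
\<close>

lemma strong_markov_drawdown:
  assumes xy: "x \<le> y" and yz: "y \<le> z" and B: "B \<in> sets borel"
    and fin: "AE \<omega> in P x. hitting_time X y \<omega> < \<infinity>"
  shows "emeasure (P x) {\<omega>\<in>space N. hit_drawdown X y \<omega> \<in> B \<and> hit_drawdown X z \<omega> \<le> d} =
    emeasure (P x) {\<omega>\<in>space N. hit_drawdown X y \<omega> \<in> B \<and> hit_drawdown X y \<omega> \<le> d} *
    emeasure (P y) {\<omega>\<in>space N. hit_drawdown X z \<omega> \<le> d}" (is "emeasure _ ?L = emeasure _ ?R * ?c")
proof -
  let ?H = "hitting_time X y"
  let ?\<Pi> = "\<Pi>\<^sub>M t\<in>{0::real..}. (borel :: ereal measure)"
  define A where "A = {\<omega>\<in>space N. X 0 \<omega> \<le> ereal y \<and> hit_drawdown X y \<omega> \<in> B \<inter> {..d}}"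
  define C where "C = {w\<in>space ?\<Pi>. rational_drawdown (\<lambda>t w. w t) z w \<le> d}"
  have [measurable]: "B \<in> sets borel" "hitting_time X y \<in> borel_measurable N"
    "hit_drawdown X y \<in> borel_measurable N" "hit_drawdown X z \<in> borel_measurable N"
    "X 0 \<in> borel_measurable N"
    using B measurable_hitting_time measurable_hit_drawdown measurable_X by auto
  have [measurable]: "rational_drawdown (\<lambda>t w. w t) z \<in> borel_measurable ?\<Pi>"
    by (rule measurable_rational_drawdown) (simp add: measurable_component_singleton)
  have C: "C \<in> sets ?\<Pi>" unfolding C_def by measurable
  \<comment> \<open>On continuous absorbed paths the countable expression defining \<open>C\<close> is the drawdown.\<close>
  have inC: "(\<lambda>t\<in>{0..}. X (T + t) \<omega>) \<in> C \<longleftrightarrow> hit_drawdown (\<lambda>t. X (T + t)) z \<omega> \<le> d"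
    if "\<omega> \<in> space N" "0 \<le> T" for \<omega> T
  proof -
    have "rational_drawdown (\<lambda>t w. w t) z (\<lambda>t\<in>{0..}. X (T + t) \<omega>) =
        rational_drawdown (\<lambda>t. X (T + t)) z \<omega>"
      by (rule rational_drawdown_cong) simp
    also have "\<dots> = hit_drawdown (\<lambda>t. X (T + t)) z \<omega>"
      using absorbing_path_shift[OF absorbing_path_X[OF that(1)] that(2)]
      by (intro max_drawdown_eq_rational[symmetric])
    finally show ?thesis by (simp add: C_def space_PiM)
  qed
  have hit: "\<exists>T. ?H \<omega> = ereal T \<and> 0 \<le> T \<and> X T \<omega> = ereal y" if "\<omega> \<in> space N" "?H \<omega> < \<infinity>" for \<omega>
    using hitting_time_attained[of X \<omega>, OF continuous_paths[OF that(1)] that(2)] by metis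
  have Aset: "A \<in> sets (filtration.pre_sigma (space N) (history_plus (space N) X) ?H)"
    unfolding A_def by (rule hit_drawdown_pre_sigma) simp
  have start': "AE \<omega> in P x. X 0 \<omega> \<le> ereal y"
    using start[of x] by eventually_elim (use xy in simp)
  have "{\<omega>\<in>A. ?H \<omega> < \<infinity> \<and> \<bar>X (real_of_ereal (?H \<omega>)) \<omega>\<bar> \<noteq> \<infinity> \<and>
      (\<lambda>t\<in>{0..}. X (real_of_ereal (?H \<omega>) + t) \<omega>) \<in> C} =
    {\<omega>\<in>space N. X 0 \<omega> \<le> ereal y \<and> ?H \<omega> < \<infinity> \<and> hit_drawdown X y \<omega> \<in> B \<and> hit_drawdown X z \<omega> \<le> d}"
    (is "?E = ?E'")
  proof (intro set_eqI)
    fix \<omega>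
    show "\<omega> \<in> ?E \<longleftrightarrow> \<omega> \<in> ?E'"
    proof (cases "\<omega> \<in> space N \<and> ?H \<omega> < \<infinity> \<and> X 0 \<omega> \<le> ereal y")
      case True
      then obtain T where T: "?H \<omega> = ereal T" "0 \<le> T" "X T \<omega> = ereal y" using hit by blast
      have "hit_drawdown X z \<omega> = max (hit_drawdown X y \<omega>) (hit_drawdown (\<lambda>t. X (T + t)) z \<omega>)"
        using True by (intro max_drawdown_after_hitting continuous_paths T yz) auto
      then show ?thesis using True T inC[of \<omega> T] by (auto simp: A_def)
    qed (auto simp: A_def)
  qed
  moreover have "emeasure (P x) ?L = emeasure (P x) ?E'"
  proof (rule emeasure_eq_AE)
    show "AE \<omega> in P x. \<omega> \<in> ?L \<longleftrightarrow> \<omega> \<in> ?E'" using fin start' by eventually_elim auto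
  qed (simp_all add: sets_P)
  ultimately have "emeasure (P x) ?L = emeasure (P x) ?E" by simp
  also have "\<dots> = (\<integral>\<^sup>+\<omega>\<in>{\<omega>\<in>A. ?H \<omega> < \<infinity> \<and> \<bar>X (real_of_ereal (?H \<omega>)) \<omega>\<bar> \<noteq> \<infinity>}.
           emeasure (P (real_of_ereal (X (real_of_ereal (?H \<omega>)) \<omega>)))
             {\<omega>'\<in>space N. (\<lambda>t\<in>{0..}. X t \<omega>') \<in> C} \<partial>P x)"
    by (rule strong_markov[OF stopping_time_hitting_time hitting_time_nonneg Aset C])
  also have "{\<omega>'\<in>space N. (\<lambda>t\<in>{0..}. X t \<omega>') \<in> C} = {\<omega>\<in>space N. hit_drawdown X z \<omega> \<le> d}"
    using inC[of _ 0] by auto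
  also have "(\<integral>\<^sup>+\<omega>\<in>{\<omega>\<in>A. ?H \<omega> < \<infinity> \<and> \<bar>X (real_of_ereal (?H \<omega>)) \<omega>\<bar> \<noteq> \<infinity>}.
           emeasure (P (real_of_ereal (X (real_of_ereal (?H \<omega>)) \<omega>)))
             {\<omega>\<in>space N. hit_drawdown X z \<omega> \<le> d} \<partial>P x) =
     (\<integral>\<^sup>+\<omega>. ?c * indicator {\<omega>\<in>A. ?H \<omega> < \<infinity>} \<omega> \<partial>P x)"
  proof (rule nn_integral_cong)
    fix \<omega> assume \<omega>: "\<omega> \<in> space (P x)"
    show "emeasure (P (real_of_ereal (X (real_of_ereal (?H \<omega>)) \<omega>)))
        {\<omega>\<in>space N. hit_drawdown X z \<omega> \<le> d} *
        indicator {\<omega>\<in>A. ?H \<omega> < \<infinity> \<and> \<bar>X (real_of_ereal (?H \<omega>)) \<omega>\<bar> \<noteq> \<infinity>} \<omega> =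
      ?c * indicator {\<omega>\<in>A. ?H \<omega> < \<infinity>} \<omega>"
      using hit[of \<omega>] \<omega> by (cases "?H \<omega> < \<infinity>") (auto simp: space_P indicator_def)
  qed
  also have "\<dots> = ?c * emeasure (P x) {\<omega>\<in>A. ?H \<omega> < \<infinity>}"
    by (rule nn_integral_cmult_indicator) (simp add: sets_P A_def)
  also have "emeasure (P x) {\<omega>\<in>A. ?H \<omega> < \<infinity>} = emeasure (P x) ?R"
  proof (rule emeasure_eq_AE)
    show "AE \<omega> in P x. \<omega> \<in> {\<omega>\<in>A. ?H \<omega> < \<infinity>} \<longleftrightarrow> \<omega> \<in> ?R"
      using fin start' AE_space by eventually_elim (auto simp: A_def space_P)
  qed (simp_all add: sets_P A_def)
  finally show ?thesis by (simp add: mult.commute)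
qed

end

section \<open>Multiplicative functions and Stieltjes integrals\<close>

lemma interval_measure_integral_bounds:
  fixes S g :: "real \<Rightarrow> real"
  assumes S: "mono S" "continuous_on UNIV S" and g: "continuous_on {a..b} g" and ab: "a \<le> b"
    and m: "\<And>z. z \<in> {a..b} \<Longrightarrow> k \<le> g z" and M: "\<And>z. z \<in> {a..b} \<Longrightarrow> g z \<le> K"
  shows "k * (S b - S a) \<le> (LINT z:{a..b}|interval_measure S. g z)"
    and "(LINT z:{a..b}|interval_measure S. g z) \<le> K * (S b - S a)"
    and "set_integrable (interval_measure S) {a..b} g"
proof -
  have e: "emeasure (interval_measure S) {a..b} = ennreal (S b - S a)"
    using S ab by (intro emeasure_interval_measure_Icc) (auto simp: mono_def)
  have S0: "0 \<le> S b - S a" using monoD[OF S(1) ab] by simp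
  have me: "measure (interval_measure S) {a..b} = S b - S a"
    using e S0 by (simp add: measure_def)
  have "set_borel_measurable borel {a..b} g"
    unfolding set_borel_measurable_def
    by (rule borel_measurable_continuous_on_indicator[OF _ g]) simp
  then have meas: "set_borel_measurable (interval_measure S) {a..b} g"
    by (simp add: set_borel_measurable_def)
  show int: "set_integrable (interval_measure S) {a..b} g"
    unfolding set_integrable_def
  proof (rule integrableI_bounded_set[where A="{a..b}" and B="max \<bar>k\<bar> \<bar>K\<bar>"])
    show "AE x in interval_measure S. x \<in> {a..b} \<longrightarrow>
        norm (indicat_real {a..b} x *\<^sub>R g x) \<le> max \<bar>k\<bar> \<bar>K\<bar>"
      using m M by (intro AE_I2) (force simp: abs_le_iff)
  qed (use e meas in \<open>auto simp: set_borel_measurable_def\<close>)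
  have intc: "set_integrable (interval_measure S) {a..b} (\<lambda>_. c)" for c :: real
    unfolding set_integrable_def by (intro integrable_scaleR_left) (use e in auto)
  have c: "(LINT z:{a..b}|interval_measure S. c) = c * (S b - S a)" for c :: real
    unfolding set_lebesgue_integral_def using me e by simp
  show "k * (S b - S a) \<le> (LINT z:{a..b}|interval_measure S. g z)"
    unfolding c[symmetric] by (intro set_integral_mono intc int m)
  show "(LINT z:{a..b}|interval_measure S. g z) \<le> K * (S b - S a)"
    unfolding c[symmetric] by (intro set_integral_mono intc int M)
qed

lemma interval_measure_integral_split:
  fixes S g :: "real \<Rightarrow> real"
  assumes S: "mono S" "continuous_on UNIV S" and g: "set_integrable (interval_measure S) {a..c} g"
    and ab: "a \<le> b" "b \<le> c"
  shows "(LINT z:{a..c}|interval_measure S. g z) =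
    (LINT z:{a..b}|interval_measure S. g z) + (LINT z:{b..c}|interval_measure S. g z)"
proof -
  have 0: "emeasure (interval_measure S) {b} = 0"
    using emeasure_interval_measure_Icc[of b b S] S by (auto simp: mono_def)
  have "{a..c} = {a..b} \<union> {b<..c}" using ab by auto
  moreover have "(LINT z:{a..b} \<union> {b<..c}|interval_measure S. g z) =
     (LINT z:{a..b}|interval_measure S. g z) + (LINT z:{b<..c}|interval_measure S. g z)"
    using ab by (intro set_integral_Un set_integrable_subset[OF g]) auto
  moreover have "(LINT z:{b<..c}|interval_measure S. g z) =
      (LINT z:{b..c}|interval_measure S. g z)"
  proof (rule set_integral_cong_set[symmetric])
    have g': "set_integrable (interval_measure S) {b..c} g" "set_integrable (interval_measure S) {b<..c} g"
      by (rule set_integrable_subset[OF g]; use ab in auto)+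
    show "set_borel_measurable (interval_measure S) {b<..c} g"
      "set_borel_measurable (interval_measure S) {b..c} g"
      using g' by (auto simp: set_integrable_def set_borel_measurable_def)
    have "AE x in interval_measure S. x \<noteq> b"
      by (rule AE_I[where N="{b}"]) (use 0 in auto)
    then show "AE x in interval_measure S. (x \<in> {b<..c}) = (x \<in> {b..c})"
      by eventually_elim auto
  qed
  ultimately show ?thesis by simp
qed

text \<open>
  The two bounds say that the logarithmic derivative of \<open>G \<beta>\<close> with respect to \<open>S\<close> is \<open>-g\<close> with
  \<open>g z = 1 / (S z - S (z - \<delta>))\<close>, while the integral \<open>I\<close> of \<open>g\<close> from \<open>\<beta>\<close> has derivative \<open>g\<close> with
  respect to \<open>S\<close>. Hence \<open>G \<beta> z * exp (I z)\<close> has derivative zero and keeps its value \<open>1\<close> at \<open>\<beta>\<close>.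
  Multiplying by the exponential, instead of taking the logarithm of \<open>G\<close>, avoids having to know
  beforehand that \<open>G\<close> is positive.
\<close>

lemma multiplicative_exp_integral:
  fixes S :: "real \<Rightarrow> real" and G :: "real \<Rightarrow> real \<Rightarrow> real"
  assumes S: "strict_mono S" and diff: "\<And>x. \<exists>D. (S has_real_derivative D) (at x)"
    and \<delta>: "0 < \<delta>" and ab: "\<beta> \<le> \<alpha>"
    and G01: "\<And>x y. \<beta> \<le> x \<Longrightarrow> x \<le> y \<Longrightarrow> y \<le> \<alpha> \<Longrightarrow> 0 \<le> G x y \<and> G x y \<le> 1"
    and mult: "\<And>y z. \<beta> \<le> y \<Longrightarrow> y \<le> z \<Longrightarrow> z \<le> \<alpha> \<Longrightarrow> G \<beta> z = G \<beta> y * G y z"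
    and G1: "G \<beta> \<beta> = 1"
    and lower: "\<And>u v. \<beta> \<le> u \<Longrightarrow> u < v \<Longrightarrow> v \<le> \<alpha> \<Longrightarrow> v - \<delta> < u \<Longrightarrow>
      1 - (S v - S u) / (S v - S (v - \<delta>)) \<le> G u v"
    and upper: "\<And>u v. \<beta> \<le> u \<Longrightarrow> u < v \<Longrightarrow> v \<le> \<alpha> \<Longrightarrow>
      G u v \<le> 1 - (S v - S u) / (S v - S (u - \<delta>))"
  shows "G \<beta> \<alpha> = exp (- (LINT z:{\<beta>..\<alpha>}|interval_measure S. 1 / (S z - S (z - \<delta>))))"
proof -
  define g where "g z = 1 / (S z - S (z - \<delta>))" for z
  define F where "F z = G \<beta> z" for z
  define I where "I z = (LINT z:{\<beta>..z}|interval_measure S. g z)" for z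
  have cS: "isCont S x" for x using diff DERIV_isCont by blast
  then have cS': "continuous_on UNIV S" by (simp add: continuous_at_imp_continuous_on)
  have mS: "mono S" using S by (rule strict_mono_mono)
  have pos: "S z - S w > 0" if "w < z" for z w using S that by (simp add: strict_monoD)
  have cg: "isCont g x" for x
    unfolding g_def using pos[of "x - \<delta>" x] \<delta>
    by (intro continuous_intros cS isCont_o2[of _ "\<lambda>z. z - \<delta>" S]) auto
  have cg': "continuous_on A g" for A by (simp add: cg continuous_at_imp_continuous_on)
  have int: "set_integrable (interval_measure S) {a..b} g" for a b
  proof (cases "a \<le> b")
    case True
    obtain k where "\<forall>z\<in>{a..b}. g k \<le> g z"
      using continuous_attains_inf[of "{a..b}" g, OF _ _ cg'] True by auto
    moreover obtain K where "\<forall>z\<in>{a..b}. g z \<le> g K"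
      using continuous_attains_sup[of "{a..b}" g, OF _ _ cg'] True by auto
    ultimately show ?thesis
      using interval_measure_integral_bounds(3)[OF mS cS' cg' True, of "g k" "g K"] by blast
  next
    case False then have "{a..b} = {}" by auto
    then show ?thesis by (simp add: set_integrable_def)
  qed
  \<comment> \<open>Derivatives with respect to \<open>S\<close> become ordinary ones by the chain rule.\<close>
  have chain: "(f has_real_derivative c * D) (at x within {\<beta>..\<alpha>})"
    if lim: "((\<lambda>y. (f y - f x) / (S y - S x)) \<longlongrightarrow> c) (at x within {\<beta>..\<alpha>})"
      and D: "(S has_real_derivative D) (at x)" for f :: "real \<Rightarrow> real" and c D x
  proof -
    have "((\<lambda>y. (S y - S x) / (y - x)) \<longlongrightarrow> D) (at x within {\<beta>..\<alpha>})"
      using has_field_derivative_at_within[OF D] by (simp add: has_field_derivative_iff)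
    from tendsto_mult[OF lim this]
    show ?thesis unfolding has_field_derivative_iff
    proof (rule Lim_transform_eventually)
      have "S y \<noteq> S x" if "y \<noteq> x" for y
        using pos[of x y] pos[of y x] that by (cases "x < y") auto
      then show "\<forall>\<^sub>F y in at x within {\<beta>..\<alpha>}.
          (f y - f x) / (S y - S x) * ((S y - S x) / (y - x)) = (f y - f x) / (y - x)"
        by (auto simp: eventually_at_filter)
    qed
  qed
  have near: "\<forall>\<^sub>F y in at x within {\<beta>..\<alpha>}. y \<in> {\<beta>..\<alpha>} \<and> y \<noteq> x \<and> \<bar>y - x\<bar> < d"
    if "0 < d" for x d
    unfolding eventually_at using that by (intro exI[of _ d]) (auto simp: dist_real_def)
  have limI: "((\<lambda>y. (I y - I x) / (S y - S x)) \<longlongrightarrow> g x) (at x within {\<beta>..\<alpha>})"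
    if x: "x \<in> {\<beta>..\<alpha>}" for x
  proof (rule tendstoI)
    fix e :: real assume e: "0 < e"
    obtain d where d: "0 < d" "\<And>z. \<bar>z - x\<bar> < d \<Longrightarrow> \<bar>g z - g x\<bar> < e / 2"
      using cg[of x, unfolded continuous_at_eps_delta, rule_format, of "e / 2"] e
      by (auto simp: dist_real_def)
    show "\<forall>\<^sub>F y in at x within {\<beta>..\<alpha>}. dist ((I y - I x) / (S y - S x)) (g x) < e"
      using near[OF d(1)]
    proof eventually_elim
      case (elim y)
      define u v where "u = min x y" and "v = max x y"
      have uv: "\<beta> \<le> u" "u < v" using x elim by (auto simp: u_def v_def)
      have S0: "S v - S u > 0" using pos uv by blast
      have "g x - e / 2 \<le> g z \<and> g z \<le> g x + e / 2" if "z \<in> {u..v}" for z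
      proof -
        have "\<bar>z - x\<bar> < d" using that elim by (auto simp: u_def v_def)
        from d(2)[OF this] show ?thesis by (simp only: abs_less_iff) linarith
      qed
      then have b: "(g x - e / 2) * (S v - S u) \<le> (LINT z:{u..v}|interval_measure S. g z)"
        "(LINT z:{u..v}|interval_measure S. g z) \<le> (g x + e / 2) * (S v - S u)"
        using interval_measure_integral_bounds(1,2)[OF mS cS' cg' less_imp_le[OF uv(2)],
            of "g x - e / 2" "g x + e / 2"] by auto
      have "(LINT z:{u..v}|interval_measure S. g z) = I v - I u"
        using interval_measure_integral_split[OF mS cS' int uv(1) less_imp_le[OF uv(2)]]
        by (simp add: I_def)
      moreover have "(I y - I x) / (S y - S x) = (I v - I u) / (S v - S u)"
        by (auto simp: u_def v_def min_def max_def divide_simps) (auto simp: algebra_simps)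
      ultimately have "g x - e / 2 \<le> (I y - I x) / (S y - S x)"
        "(I y - I x) / (S y - S x) \<le> g x + e / 2"
        using b by (simp_all only: pos_le_divide_eq[OF S0] pos_divide_le_eq[OF S0])
      then show ?case using e by (simp add: dist_real_def abs_less_iff)
    qed
  qed
  have limF: "((\<lambda>y. (F y - F x) / (S y - S x)) \<longlongrightarrow> - F x * g x) (at x within {\<beta>..\<alpha>})"
    if x: "x \<in> {\<beta>..\<alpha>}" for x
  proof -
    \<comment> \<open>Ordering \<open>x\<close> and \<open>y\<close> treats the left and the right derivative at once.\<close>
    define u v where "u y = min x y" and "v y = max x y" for y
    define q where "q y = (1 - G (u y) (v y)) / (S (v y) - S (u y))" for y
    define lo where "lo y = 1 / (S (v y) - S (u y - \<delta>))" for y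
    define hi where "hi y = 1 / (S (v y) - S (v y - \<delta>))" for y
    have ux: "u x = x" "v x = x" by (auto simp: u_def v_def)
    have cu: "isCont u x" "isCont v x" unfolding u_def v_def by (intro continuous_intros)+
    have cSu: "isCont (\<lambda>y. S (u y)) x" "isCont (\<lambda>y. S (v y)) x"
        "isCont (\<lambda>y. S (u y - \<delta>)) x" "isCont (\<lambda>y. S (v y - \<delta>)) x"
      by (rule isCont_o2[OF _ cS]; intro continuous_intros cu)+
    have "isCont lo x" "isCont hi x"
      unfolding lo_def hi_def using pos[of "x - \<delta>" x] \<delta>
      by (intro continuous_intros cSu; simp add: ux)+
    then have lim: "(lo \<longlongrightarrow> g x) (at x within {\<beta>..\<alpha>})" "(hi \<longlongrightarrow> g x) (at x within {\<beta>..\<alpha>})"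
      by (auto simp: isCont_def lo_def hi_def g_def ux intro: tendsto_within_subset)
    have both: "\<forall>\<^sub>F y in at x within {\<beta>..\<alpha>}. lo y \<le> q y \<and> q y \<le> hi y"
      using near[OF \<delta>]
    proof eventually_elim
      case (elim y)
      have uv: "\<beta> \<le> u y" "u y < v y" "v y \<le> \<alpha>" "v y - \<delta> < u y"
        using x elim by (auto simp: u_def v_def)
      have S0: "S (v y) - S (u y) > 0" "S (v y) - S (u y - \<delta>) > 0" "S (v y) - S (v y - \<delta>) > 0"
        using pos[of "u y" "v y"] pos[of "u y - \<delta>" "v y"] pos[of "v y - \<delta>" "v y"] uv \<delta>
        by simp_all
      show ?case
        using lower[OF uv] upper[OF uv(1-3)] S0 unfolding lo_def q_def hi_def
        by (simp add: field_simps)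
    qed
    have q: "(q \<longlongrightarrow> g x) (at x within {\<beta>..\<alpha>})"
      by (rule tendsto_sandwich[OF _ _ lim]) (use both in \<open>auto elim: eventually_mono\<close>)
    have diffF: "\<forall>\<^sub>F y in at x within {\<beta>..\<alpha>}. F (v y) - F (u y) = - F (u y) * (q y * (S (v y) - S (u y)))"
      using near[OF \<delta>]
    proof eventually_elim
      case (elim y)
      have uv: "\<beta> \<le> u y" "u y < v y" "v y \<le> \<alpha>" using x elim by (auto simp: u_def v_def)
      have q: "q y * (S (v y) - S (u y)) = 1 - G (u y) (v y)"
        using pos[OF uv(2)] by (simp add: q_def)
      have "G \<beta> (v y) = G \<beta> (u y) * G (u y) (v y)" using mult[of "u y" "v y"] uv by simp
      then show ?case unfolding F_def q by (simp add: algebra_simps)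
    qed
    have Fu: "((\<lambda>y. F (u y)) \<longlongrightarrow> F x) (at x within {\<beta>..\<alpha>})"
    proof (rule LIM_zero_cancel, rule tendsto_0_le[where K=1])
      have "((\<lambda>y. q y * (S (v y) - S (u y))) \<longlongrightarrow> g x * (S (v x) - S (u x))) (at x within {\<beta>..\<alpha>})"
        by (intro tendsto_mult q tendsto_diff)
          (use cSu in \<open>auto simp: isCont_def intro: tendsto_within_subset\<close>)
      then show "((\<lambda>y. q y * (S (v y) - S (u y))) \<longlongrightarrow> 0) (at x within {\<beta>..\<alpha>})"
        by (simp add: ux)
      show "\<forall>\<^sub>F y in at x within {\<beta>..\<alpha>}. norm (F (u y) - F x) \<le> norm (q y * (S (v y) - S (u y))) * 1"
        using diffF near[OF \<delta>]
      proof eventually_elim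
        case (elim y)
        have "\<bar>F (u y) - F x\<bar> \<le> \<bar>F (v y) - F (u y)\<bar>" by (auto simp: u_def v_def min_def max_def)
        also have "\<dots> = \<bar>F (u y)\<bar> * \<bar>q y * (S (v y) - S (u y))\<bar>"
          using elim by (simp add: abs_mult)
        also have "\<dots> \<le> 1 * \<bar>q y * (S (v y) - S (u y))\<bar>"
          using G01[of \<beta> "u y"] x elim ab
          by (intro mult_right_mono) (auto simp: F_def u_def)
        finally show ?case by simp
      qed
    qed
    have "((\<lambda>y. - F (u y) * q y) \<longlongrightarrow> - F x * g x) (at x within {\<beta>..\<alpha>})"
      by (intro tendsto_intros Fu q)
    then show ?thesis
    proof (rule Lim_transform_eventually)
      show "\<forall>\<^sub>F y in at x within {\<beta>..\<alpha>}. - F (u y) * q y = (F y - F x) / (S y - S x)"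
        using diffF near[OF \<delta>]
      proof eventually_elim
        case (elim y)
        have "S (v y) - S (u y) > 0" using elim by (intro pos) (auto simp: u_def v_def)
        then have "- F (u y) * q y = (F (v y) - F (u y)) / (S (v y) - S (u y))"
          using elim by (simp add: field_simps)
        also have "\<dots> = (F y - F x) / (S y - S x)"
          by (auto simp: u_def v_def min_def max_def divide_simps) (auto simp: algebra_simps)
        finally show ?case .
      qed
    qed
  qed
  have "\<exists>c. \<forall>x\<in>{\<beta>..\<alpha>}. F x * exp (I x) = c"
  proof (rule has_field_derivative_zero_constant)
    fix x assume x: "x \<in> {\<beta>..\<alpha>}"
    obtain D where D: "(S has_real_derivative D) (at x)" using diff by blast
    show "((\<lambda>x. F x * exp (I x)) has_real_derivative 0) (at x within {\<beta>..\<alpha>})"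
      by (rule derivative_eq_intros chain[OF limI[OF x] D] chain[OF limF[OF x] D] refl)+
        (simp add: algebra_simps)
  qed simp
  then have "F \<alpha> * exp (I \<alpha>) = F \<beta> * exp (I \<beta>)" using ab by auto
  moreover have "I \<beta> = 0"
    using interval_measure_integral_bounds(1,2)[OF mS cS' cg' order_refl, of \<beta> "g \<beta>" "g \<beta>"]
    by (simp add: I_def)
  ultimately have "F \<alpha> * exp (I \<alpha>) = 1" by (simp add: F_def G1)
  then have "F \<alpha> = exp (- I \<alpha>)" by (simp add: exp_minus field_simps)
  then show ?thesis by (simp add: F_def I_def g_def)
qed

section \<open>Conditional laws of a maximum\<close>

lemma sets_borel_ereal_atMost: "sets (borel :: ereal measure) = sigma_sets UNIV (range atMost)"
proof -
  have "(borel :: ereal measure) = sigma UNIV (range atMost)"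
  proof (rule borel_eq_sigmaI1[OF borel_Ioi])
    fix E :: "ereal set" assume "E \<in> range greaterThan"
    then obtain x where "E = {x<..}" by auto
    then have "E = UNIV - {..x}" by auto
    also have "\<dots> \<in> sigma_sets UNIV (range atMost)"
      by (rule sigma_sets.Compl) auto
    finally show "E \<in> sets (sigma UNIV (range atMost))" by simp
  qed auto
  then have "sets (borel :: ereal measure) = sets (sigma UNIV (range atMost))" by simp
  then show ?thesis by simp
qed

lemma measurable_distr_max:
  assumes "prob_space \<nu>" "sets \<nu> = sets (borel :: ereal measure)"
  shows "(\<lambda>z. distr \<nu> borel (max z)) \<in> borel \<rightarrow>\<^sub>M prob_algebra borel"
proof (rule measurable_distr_prob_space2)
  show "(\<lambda>_. \<nu>) \<in> borel \<rightarrow>\<^sub>M prob_algebra borel"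
    using assms by (intro measurable_const) (auto simp: space_prob_algebra)
  show "(\<lambda>(z, w). max z w) \<in> (borel :: ereal measure) \<Otimes>\<^sub>M borel \<rightarrow>\<^sub>M borel" by measurable
qed

lemma emeasure_distr_max:
  assumes "sets \<nu> = sets (borel :: ereal measure)"
  shows "emeasure (distr \<nu> borel (max z)) {..d} = indicator {..d} z * emeasure \<nu> {..d}"
proof -
  have [measurable]: "max z \<in> \<nu> \<rightarrow>\<^sub>M borel"
    unfolding measurable_cong_sets[OF assms refl] by measurable
  have "space \<nu> = UNIV" using sets_eq_imp_space_eq[OF assms] by simp
  then have "max z -` {..d} \<inter> space \<nu> = (if z \<le> d then {..d} else {})" by auto
  then show ?thesis by (subst emeasure_distr) auto
qed

text \<open>
  The hypothesis on the joint law says that \<open>Y\<close> is distributed, jointly with \<open>Z\<close>, like \<open>max Z W\<close> with an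
  independent \<open>W\<close> of law \<open>\<nu>\<close>; given \<open>Z = z\<close>, the law of \<open>Y\<close> is that of \<open>max z W\<close>. The variable \<open>W\<close> is
  not constructed: for fixed \<open>B\<close>, both sides of the defining identity are finite measures in \<open>A\<close>, and
  they agree on the half-lines, which form a generating \<open>\<inter>\<close>-stable system.
\<close>

lemma regular_conditional_distribution_max:
  assumes M: "prob_space M" and Y[measurable]: "Y \<in> borel_measurable M"
    and Z[measurable]: "Z \<in> borel_measurable M"
    and \<nu>: "prob_space \<nu>" "sets \<nu> = sets (borel :: ereal measure)"
    and law: "\<And>B d. B \<in> sets borel \<Longrightarrow> emeasure M {\<omega>\<in>space M. Z \<omega> \<in> B \<and> Y \<omega> \<le> d} =
      emeasure M {\<omega>\<in>space M. Z \<omega> \<in> B \<and> Z \<omega> \<le> d} * emeasure \<nu> {..d}"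
  shows "regular_conditional_distribution M borel Y borel Z (\<lambda>z. distr \<nu> borel (max z))"
  unfolding regular_conditional_distribution_def
proof (intro conjI ballI Y Z measurable_distr_max[OF \<nu>])
  interpret M: prob_space M by fact
  fix A B :: "ereal set" assume A: "A \<in> sets borel" and B[measurable]: "B \<in> sets borel"
  let ?\<kappa> = "\<lambda>z. distr \<nu> borel (max z)"
  let ?W = "density (distr M borel Z) (indicator B)"
  define \<mu> where "\<mu> = distr (density M (indicator {\<omega>\<in>space M. Z \<omega> \<in> B})) borel Y"
  define \<mu>' where "\<mu>' = ?W \<bind> ?\<kappa>"
  have \<kappa>: "?\<kappa> \<in> ?W \<rightarrow>\<^sub>M subprob_algebra borel"
    using measurable_prob_algebraD[OF measurable_distr_max[OF \<nu>]] by simp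
  have \<kappa>m: "(\<lambda>z. emeasure (?\<kappa> z) A) \<in> borel_measurable borel" if "A \<in> sets borel" for A
    using measurable_prob_algebraD[OF measurable_distr_max[OF \<nu>]] that
    by (rule measurable_emeasure_kernel)
  have \<mu>: "emeasure \<mu> A = emeasure M {\<omega>\<in>space M. Y \<omega> \<in> A \<and> Z \<omega> \<in> B}" if "A \<in> sets borel" for A
  proof -
    have "emeasure \<mu> A = emeasure M ({\<omega>\<in>space M. Z \<omega> \<in> B} \<inter> (Y -` A \<inter> space M))"
      unfolding \<mu>_def using that
      by (simp add: emeasure_distr emeasure_density indicator_inter_arith[symmetric])
    also have "{\<omega>\<in>space M. Z \<omega> \<in> B} \<inter> (Y -` A \<inter> space M) =
        {\<omega>\<in>space M. Y \<omega> \<in> A \<and> Z \<omega> \<in> B}" by auto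
    finally show ?thesis .
  qed
  have \<mu>': "emeasure \<mu>' A = (\<integral>\<^sup>+z\<in>B. emeasure (?\<kappa> z) A \<partial>distr M borel Z)" if "A \<in> sets borel" for A
    unfolding \<mu>'_def using that \<kappa>m[OF that]
    by (simp add: emeasure_bind[OF _ \<kappa>] nn_integral_density mult.commute)
  have "\<mu> = \<mu>'"
  proof (rule measure_eqI_generator_eq[where E = "range atMost" and A = "\<lambda>_. {..\<infinity>}" and \<Omega> = UNIV])
    show "Int_stable (range (atMost :: ereal \<Rightarrow> _))"
      by (auto simp: Int_stable_def)
    show "sets \<mu> = sigma_sets UNIV (range atMost)" "sets \<mu>' = sigma_sets UNIV (range atMost)"
      using sets_bind[of ?W ?\<kappa> borel]
      by (auto simp: \<mu>_def \<mu>'_def sets_borel_ereal_atMost[symmetric])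
    show "emeasure \<mu> {..\<infinity>} \<noteq> \<infinity>" by (simp add: \<mu>)
    fix E assume "E \<in> range (atMost :: ereal \<Rightarrow> _)"
    then obtain d where E: "E = {..d}" by auto
    have "emeasure \<mu> E = emeasure M {\<omega>\<in>space M. Z \<omega> \<in> B \<and> Z \<omega> \<le> d} * emeasure \<nu> {..d}"
      unfolding law[OF B, symmetric] by (simp add: \<mu> E conj_commute)
    also have "emeasure M {\<omega>\<in>space M. Z \<omega> \<in> B \<and> Z \<omega> \<le> d} = emeasure (distr M borel Z) (B \<inter> {..d})"
      by (subst emeasure_distr) (auto intro!: arg_cong[where f = "emeasure M"])
    also have "\<dots> * emeasure \<nu> {..d} =
        (\<integral>\<^sup>+z. emeasure \<nu> {..d} * indicator (B \<inter> {..d}) z \<partial>distr M borel Z)"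
      by (subst nn_integral_cmult_indicator) (auto simp: mult.commute)
    also have "\<dots> = emeasure \<mu>' E"
      unfolding E by (subst \<mu>') (auto simp: emeasure_distr_max[OF \<nu>(2)] indicator_inter_arith ac_simps)
    finally show "emeasure \<mu> E = emeasure \<mu>' E" .
  qed auto
  then show "emeasure M {\<omega>\<in>space M. Y \<omega> \<in> A \<and> Z \<omega> \<in> B} =
      (\<integral>\<^sup>+z\<in>B. emeasure (?\<kappa> z) A \<partial>distr M borel Z)"
    using \<mu>[OF A] \<mu>'[OF A] by simp
qed

text \<open>
  Right-continuity of distribution functions lets one pass from countably many half-lines to all of
  them, which is what makes the exceptional set in the next lemma independent of the half-line.
\<close>

lemma measure_atMost_le_if_rational:
  assumes A: "prob_space A" "sets A = sets (borel :: ereal measure)"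
    and B: "prob_space B" "sets B = sets (borel :: ereal measure)"
    and eq: "\<And>q. q \<in> \<rat> \<Longrightarrow> measure A {..ereal q} = measure B {..ereal q}"
  shows "measure A {..ereal d} \<le> measure B {..ereal d}"
proof -
  interpret A: prob_space A by fact
  interpret B: prob_space B by fact
  let ?E = "\<lambda>n. {..ereal (d + 1 / real (Suc n))}"
  have "(\<lambda>n. measure B (?E n)) \<longlonglongrightarrow> measure B (\<Inter>n. ?E n)"
  proof (rule B.finite_Lim_measure_decseq)
    show "range ?E \<subseteq> sets B" unfolding B(2) by (intro image_subsetI) (rule atMost_borel)
    show "decseq ?E" unfolding decseq_def
    proof (intro allI impI iffD2[OF atMost_subset_iff])
      fix m n assume mn: "m \<le> (n::nat)"
      show "ereal (d + 1 / real (Suc n)) \<le> ereal (d + 1 / real (Suc m))"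
        unfolding ereal_less_eq using mn by (intro add_left_mono frac_le) auto
    qed
  qed
  moreover have "(\<Inter>n. ?E n) = {..ereal d}"
  proof (intro set_eqI iffI)
    fix w assume w: "w \<in> (\<Inter>n. ?E n)"
    show "w \<in> {..ereal d}"
    proof (rule ccontr)
      assume "w \<notin> {..ereal d}"
      then have "ereal d < w" by simp
      then obtain r where r: "ereal d < ereal r" "ereal r < w" using ereal_dense2 by blast
      then obtain n where "1 / real (Suc n) < r - d"
        using reals_Archimedean[of "r - d"] by (auto simp: inverse_eq_divide)
      then have "ereal (d + 1 / real (Suc n)) \<le> ereal r" by (simp only: ereal_less_eq)
      moreover have "w \<le> ereal (d + 1 / real (Suc n))" using w by blast
      ultimately have "w \<le> ereal r" by (rule order_trans[rotated])
      then show False using r(2) by simp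
    qed
  next
    fix w assume "w \<in> {..ereal d}"
    then show "w \<in> (\<Inter>n. ?E n)" by (auto intro: order_trans[of w "ereal d"])
  qed
  moreover have "measure A {..ereal d} \<le> measure B (?E n)" for n
  proof -
    obtain q where q: "q \<in> \<rat>" "d < q" "q < d + 1 / real (Suc n)"
      using Rats_dense_in_real[of d "d + 1 / real (Suc n)"] by auto
    have "measure A {..ereal d} \<le> measure A {..ereal q}"
      using q A(2) by (intro A.finite_measure_mono) auto
    also have "\<dots> = measure B {..ereal q}" using q by (intro eq)
    also have "\<dots> \<le> measure B (?E n)"
      using q B(2) by (intro B.finite_measure_mono) auto
    finally show ?thesis .
  qed
  ultimately show ?thesis by (intro LIMSEQ_le_const) auto
qed

lemma regular_conditional_distribution_AE_unique:
  assumes M: "prob_space M"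
    and 1: "regular_conditional_distribution M (borel :: ereal measure) Y L Z \<kappa>"
    and 2: "regular_conditional_distribution M borel Y L Z \<kappa>'"
  shows "AE z in distr M L Z. \<forall>d. measure (\<kappa> z) {..ereal d} = measure (\<kappa>' z) {..ereal d}"
proof -
  have Z: "Z \<in> M \<rightarrow>\<^sub>M L" and \<kappa>: "\<kappa> \<in> L \<rightarrow>\<^sub>M prob_algebra borel" "\<kappa>' \<in> L \<rightarrow>\<^sub>M prob_algebra borel"
    using 1 2 by (auto simp: regular_conditional_distribution_def)
  interpret M: prob_space M by fact
  interpret Z: prob_space "distr M L Z" by (rule M.prob_space_distr[OF Z])
  have "AE z in distr M L Z. emeasure (\<kappa> z) A = emeasure (\<kappa>' z) A" if A: "A \<in> sets borel" for A
  proof (rule Z.density_unique_finite_measure)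
    show "(\<lambda>z. emeasure (\<kappa> z) A) \<in> borel_measurable (distr M L Z)"
      "(\<lambda>z. emeasure (\<kappa>' z) A) \<in> borel_measurable (distr M L Z)"
      using measurable_emeasure_kernel[OF measurable_prob_algebraD A] \<kappa> by simp_all
    fix B assume "B \<in> sets (distr M L Z)"
    then show "(\<integral>\<^sup>+z. emeasure (\<kappa> z) A * indicator B z \<partial>distr M L Z) =
        (\<integral>\<^sup>+z. emeasure (\<kappa>' z) A * indicator B z \<partial>distr M L Z)"
      using 1 2 A unfolding regular_conditional_distribution_def by fastforce
  qed auto
  then have "AE z in distr M L Z. \<forall>q\<in>\<rat>. emeasure (\<kappa> z) {..ereal q} = emeasure (\<kappa>' z) {..ereal q}"
    by (intro AE_ball_countable[THEN iffD2] countable_rat) auto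
  then show ?thesis
    using AE_space
  proof eventually_elim
    case (elim z)
    have "z \<in> space L" using elim by simp
    then have p: "prob_space (\<kappa> z)" "sets (\<kappa> z) = sets borel"
        "prob_space (\<kappa>' z)" "sets (\<kappa>' z) = sets borel"
      using \<kappa>[THEN measurable_space] by (auto simp: space_prob_algebra)
    have eq: "measure (\<kappa> z) {..ereal q} = measure (\<kappa>' z) {..ereal q}" if "q \<in> \<rat>" for q
      using elim(1) that by (simp add: measure_def)
    show ?case
    proof (intro allI antisym)
      fix d
      show "measure (\<kappa> z) {..ereal d} \<le> measure (\<kappa>' z) {..ereal d}"
        by (rule measure_atMost_le_if_rational[OF p eq])
      show "measure (\<kappa>' z) {..ereal d} \<le> measure (\<kappa> z) {..ereal d}"
        by (rule measure_atMost_le_if_rational[OF p(3,4,1,2) eq[symmetric]])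
    qed
  qed
qed

section \<open>The law of the drawdown at a hitting time\<close>

context regular_diffusion
begin

text \<open>
  The exit time from \<open>{a<..<y}\<close> has finite mean by the Green function formula, so almost surely
  \<open>a\<close> is hit before \<open>y\<close> if \<open>y\<close> is never hit. That has probability \<open>(S y - S x) / (S y - S a)\<close>,
  which tends to zero as \<open>a\<close> tends to \<open>-\<infinity>\<close> because \<open>S\<close> is unbounded below.
\<close>

lemma hitting_time_finite:
  assumes scale: "scale_function N P X S" and speed: "speed_measure P X S m"
    and bot: "filterlim S at_bot at_bot" and xy: "x \<le> y"
  shows "AE \<omega> in P x. hitting_time X y \<omega> < \<infinity>"
proof (cases "x = y")
  case True
  show ?thesis
    using start[of x]
  proof eventually_elim
    case (elim \<omega>)
    then have "hitting_time X y \<omega> \<le> ereal 0" using True by (intro hitting_time_le) auto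
    then show ?case by (auto intro: order.strict_trans1)
  qed
next
  case False
  then have xy: "x < y" using xy by simp
  interpret prob_space "P x" by (rule prob_space_P)
  have S: "strict_mono S" using scale by (simp add: scale_function_def)
  have [measurable]: "hitting_time X \<eta> \<in> borel_measurable (P x)" for \<eta>
    using measurable_hitting_time by (simp add: measurable_cong_sets[OF sets_P refl])
  let ?p = "prob {\<omega>\<in>space (P x). hitting_time X y \<omega> = \<infinity>}"
  have le: "?p \<le> (S y - S x) / (S y - S a)" if a: "a < x" for a
  proof -
    have "(\<integral>\<^sup>+\<omega>. e2ennreal (min (hitting_time X a \<omega>) (hitting_time X y \<omega>)) \<partial>P x) =
        (\<integral>\<^sup>+z\<in>{a<..<y}. ennreal (green S a y x z) \<partial>m)"
      using speed a xy unfolding speed_measure_def by blast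
    also have "\<dots> \<le> (\<integral>\<^sup>+z. ennreal (S y - S a) * indicator {a..y} z \<partial>m)"
    proof (rule nn_integral_mono)
      fix z
      have "green S a y x z \<le> S y - S a" if z: "a < z" "z < y"
      proof -
        have "S a < S (min x z)" "S (max x z) < S y" "S (min x z) \<le> S y" "S a \<le> S (max x z)" "S a < S y"
          using S a xy z by (auto simp: strict_mono_less strict_mono_less_eq)
        then have "(S (min x z) - S a) * (S y - S (max x z)) \<le> (S y - S a) * (S y - S a)"
          by (intro mult_mono) auto
        then show ?thesis using \<open>S a < S y\<close> by (simp add: green_def divide_le_eq)
      qed
      then show "ennreal (green S a y x z) * indicator {a<..<y} z \<le> ennreal (S y - S a) * indicator {a..y} z"
        by (auto simp: indicator_def intro: ennreal_leI)
    qed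
    also have "\<dots> = ennreal (S y - S a) * emeasure m {a..y}"
      using speed by (intro nn_integral_cmult_indicator) (simp add: speed_measure_def)
    also have "\<dots> < \<infinity>"
      using speed by (auto simp: speed_measure_def ennreal_mult_less_top)
    finally have "AE \<omega> in P x. e2ennreal (min (hitting_time X a \<omega>) (hitting_time X y \<omega>)) \<noteq> \<infinity>"
      by (intro nn_integral_PInf_AE) auto
    then have "AE \<omega> in P x. hitting_time X y \<omega> = \<infinity> \<longrightarrow> hitting_time X a \<omega> < hitting_time X y \<omega>"
      by eventually_elim (auto simp: min_def split: if_splits)
    then have "?p \<le> prob {\<omega>\<in>space (P x). hitting_time X a \<omega> < hitting_time X y \<omega>}"
      by (intro finite_measure_mono_AE) auto
    also have "\<dots> = (S y - S x) / (S y - S a)"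
      using scale a xy by (simp add: scale_function_def space_P)
    finally show ?thesis .
  qed
  have "?p = 0"
  proof (rule ccontr)
    assume "?p \<noteq> 0"
    then have p: "?p > 0" by (simp add: zero_less_measure_iff)
    \<comment> \<open>With \<open>a\<close> so far down, the exit probability is at most half of \<open>?p\<close>.\<close>
    have "eventually (\<lambda>a. S a \<le> S y - 2 * (S y - S x) / ?p \<and> a < x) at_bot"
      using bot[unfolded filterlim_at_bot] by (intro eventually_conj) (auto simp: eventually_gt_at_bot)
    then obtain a where a: "S a \<le> S y - 2 * (S y - S x) / ?p" "a < x"
      using eventually_happens[of _ "at_bot :: real filter"] by auto
    have pos: "0 < S y - S x" "0 < S y - S a"
      using S xy a(2) by (auto simp: strict_mono_less)
    have "2 * (S y - S x) \<le> ?p * (S y - S a)" using a(1) p by (simp add: field_simps)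
    moreover have "?p * (S y - S a) \<le> S y - S x" using le[OF a(2)] pos by (simp add: field_simps)
    ultimately show False using pos by simp
  qed
  then have "AE \<omega> in P x. \<not> hitting_time X y \<omega> = \<infinity>"
    by (subst (asm) prob_Collect_eq_0) auto
  then show ?thesis by eventually_elim auto
qed

text \<open>
  A path started at \<open>u\<close> that reaches \<open>u - d\<close> before \<open>v\<close> has by then a drawdown of at least \<open>d\<close>. This is
  incompatible with a drawdown of at most \<open>\<delta>\<close> only for \<open>d > \<delta>\<close>, so the bound is obtained for such \<open>d\<close>
  first and then for \<open>d = \<delta>\<close> by continuity of \<open>S\<close>.
\<close>

lemma drawdown_probability_upper:
  assumes scale: "scale_function N P X S" and uv: "u < v" and \<delta>: "0 < \<delta>"
  shows "measure (P u) {\<omega>\<in>space N. hit_drawdown X v \<omega> \<le> ereal \<delta>} \<le>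
    1 - (S v - S u) / (S v - S (u - \<delta>))" (is "?p \<le> _")
proof -
  interpret prob_space "P u" by (rule prob_space_P)
  have S: "strict_mono S" and cS: "continuous_on UNIV S"
    using scale by (auto simp: scale_function_def)
  have [measurable]: "hitting_time X \<eta> \<in> borel_measurable (P u)" "hit_drawdown X \<eta> \<in> borel_measurable (P u)" for \<eta>
    using measurable_hitting_time measurable_hit_drawdown
    by (simp_all add: measurable_cong_sets[OF sets_P refl])
  have le: "?p \<le> 1 - (S v - S u) / (S v - S (u - d))" if d: "\<delta> < d" for d
  proof -
    let ?E = "{\<omega>\<in>space (P u). hitting_time X (u - d) \<omega> < hitting_time X v \<omega>}"
    have "?p \<le> prob (space (P u) - ?E)"
    proof (rule finite_measure_mono_AE)
      show "AE \<omega> in P u. \<omega> \<in> {\<omega>\<in>space N. hit_drawdown X v \<omega> \<le> ereal \<delta>} \<longrightarrow> \<omega> \<in> space (P u) - ?E"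
        using start[of u]
      proof eventually_elim
        case (elim \<omega>)
        have False if "\<omega> \<in> space N" "hit_drawdown X v \<omega> \<le> ereal \<delta>"
          "hitting_time X (u - d) \<omega> < hitting_time X v \<omega>"
        proof -
          have "ereal d \<le> hit_drawdown X v \<omega>"
            using large_drawdown[of X \<omega>, OF continuous_paths[OF that(1)] elim that(3)] .
          then have "ereal d \<le> ereal \<delta>" using that(2) by (rule order_trans)
          then show False using d by simp
        qed
        then show ?case by (auto simp: space_P)
      qed
    qed measurable
    also have "\<dots> = 1 - prob ?E" by (rule prob_compl) measurable
    also have "prob ?E = (S v - S u) / (S v - S (u - d))"
      using scale uv d \<delta> by (simp add: scale_function_def space_P)
    finally show ?thesis .
  qed
  have "isCont S x" for x using cS by (simp add: continuous_on_eq_continuous_at)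
  then have "isCont (\<lambda>d. 1 - (S v - S u) / (S v - S (u - d))) \<delta>"
    using strict_monoD[OF S, of "u - \<delta>" v] uv \<delta>
    by (intro continuous_intros isCont_o2[of _ "\<lambda>d. u - d" S]) auto
  then have "((\<lambda>d. 1 - (S v - S u) / (S v - S (u - d))) \<longlongrightarrow> 1 - (S v - S u) / (S v - S (u - \<delta>))) (at_right \<delta>)"
    unfolding isCont_def by (rule tendsto_within_subset) simp
  then show ?thesis
    by (rule tendsto_lowerbound) (auto simp: eventually_at_right_less le intro: eventually_mono[OF eventually_at_right_less])
qed

lemma drawdown_probability_lower:
  assumes scale: "scale_function N P X S" and uv: "u < v" "v - \<delta> < u"
    and fin: "AE \<omega> in P u. hitting_time X v \<omega> < \<infinity>"
  shows "1 - (S v - S u) / (S v - S (v - \<delta>)) \<le>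
    measure (P u) {\<omega>\<in>space N. hit_drawdown X v \<omega> \<le> ereal \<delta>}" (is "_ \<le> ?p")
proof -
  interpret prob_space "P u" by (rule prob_space_P)
  have [measurable]: "hitting_time X \<eta> \<in> borel_measurable (P u)" "hit_drawdown X \<eta> \<in> borel_measurable (P u)" for \<eta>
    using measurable_hitting_time measurable_hit_drawdown
    by (simp_all add: measurable_cong_sets[OF sets_P refl])
  let ?E = "{\<omega>\<in>space (P u). hitting_time X (v - \<delta>) \<omega> < hitting_time X v \<omega>}"
  have "(S v - S u) / (S v - S (v - \<delta>)) = prob ?E"
    using scale uv by (simp add: scale_function_def space_P)
  moreover have "1 - prob ?E = prob (space (P u) - ?E)" by (rule prob_compl[symmetric]) measurable
  moreover have "\<dots> \<le> ?p"
  proof (rule finite_measure_mono_AE)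
    show "AE \<omega> in P u. \<omega> \<in> space (P u) - ?E \<longrightarrow> \<omega> \<in> {\<omega>\<in>space N. hit_drawdown X v \<omega> \<le> ereal \<delta>}"
      using start[of u] fin
    proof eventually_elim
      case (elim \<omega>)
      then show ?case
        using no_large_drawdown[of X \<omega> u v \<delta>] uv continuous_paths[of \<omega>] by (auto simp: space_P)
    qed
    show "{\<omega>\<in>space N. hit_drawdown X v \<omega> \<le> ereal \<delta>} \<in> events"
      unfolding space_P[of u, symmetric] by measurable
  qed
  ultimately show ?thesis by simp
qed

text \<open>
  By the strong Markov property the probabilities of climbing from \<open>x\<close> to \<open>y\<close> without a drawdown above
  \<open>\<delta>\<close> are multiplicative along a chain of levels; together with the two exit bounds for short climbs this
  determines them.
\<close>

lemma drawdown_probability: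
  assumes scale: "scale_function N P X S" and diff: "\<And>x. \<exists>D. (S has_real_derivative D) (at x)"
    and fin: "\<And>x y. x \<le> y \<Longrightarrow> AE \<omega> in P x. hitting_time X y \<omega> < \<infinity>"
    and \<delta>: "0 < \<delta>" and ab: "\<beta> \<le> \<alpha>"
  shows "measure (P \<beta>) {\<omega>\<in>space N. hit_drawdown X \<alpha> \<omega> \<le> ereal \<delta>} =
    exp (- (LINT z:{\<beta>..\<alpha>}|interval_measure S. 1 / (S z - S (z - \<delta>))))"
proof (rule multiplicative_exp_integral[where G = "\<lambda>x y.
    measure (P x) {\<omega>\<in>space N. hit_drawdown X y \<omega> \<le> ereal \<delta>}", OF _ diff \<delta> ab])
  show "strict_mono S" using scale by (simp add: scale_function_def)
  show "0 \<le> measure (P x) {\<omega>\<in>space N. hit_drawdown X y \<omega> \<le> ereal \<delta>} \<and>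
     measure (P x) {\<omega>\<in>space N. hit_drawdown X y \<omega> \<le> ereal \<delta>} \<le> 1" for x y
    using prob_space.prob_le_1[OF prob_space_P] by auto
  show "measure (P \<beta>) {\<omega>\<in>space N. hit_drawdown X z \<omega> \<le> ereal \<delta>} =
     measure (P \<beta>) {\<omega>\<in>space N. hit_drawdown X y \<omega> \<le> ereal \<delta>} *
     measure (P y) {\<omega>\<in>space N. hit_drawdown X z \<omega> \<le> ereal \<delta>}" if "\<beta> \<le> y" "y \<le> z" for y z
  proof -
    have "AE \<omega> in P \<beta>. hitting_time X y \<omega> < \<infinity>" using that by (intro fin)
    from strong_markov_drawdown[OF that, of UNIV, OF _ this]
    show ?thesis by (simp add: measure_def enn2real_mult)
  qed
  have "AE \<omega> in P \<beta>. \<omega> \<in> {\<omega>\<in>space N. hit_drawdown X \<beta> \<omega> \<le> ereal \<delta>}"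
    using start[of \<beta>] fin[OF order_refl, of \<beta>] AE_space
  proof eventually_elim
    case (elim \<omega>)
    have "hitting_time X \<beta> \<omega> \<le> ereal 0" using elim by (intro hitting_time_le) auto
    also have "\<dots> \<le> hitting_time X (\<beta> - \<delta>) \<omega>"
      using hitting_time_nonneg[of X] by (simp add: zero_ereal_def)
    finally show ?case
      using elim no_large_drawdown[of X \<omega> \<beta> \<beta> \<delta>] \<delta> continuous_paths[of \<omega>]
      by (simp add: space_P)
  qed
  moreover have "{\<omega>\<in>space N. hit_drawdown X \<beta> \<omega> \<le> ereal \<delta>} \<in> sets (P \<beta>)"
    using measurable_hit_drawdown[of \<beta>] unfolding sets_P by measurable
  ultimately show "measure (P \<beta>) {\<omega>\<in>space N. hit_drawdown X \<beta> \<omega> \<le> ereal \<delta>} = 1"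
    using prob_space.prob_eq_1[OF prob_space_P] by blast
next
  show "1 - (S v - S u) / (S v - S (v - \<delta>)) \<le>
      measure (P u) {\<omega>\<in>space N. hit_drawdown X v \<omega> \<le> ereal \<delta>}"
    if "u < v" "v - \<delta> < u" for u v
    using that by (intro drawdown_probability_lower scale fin) auto
qed (auto intro: drawdown_probability_upper scale \<delta>)

end

theorem proposition5p10:
  fixes N :: "'w measure" and P :: "real \<Rightarrow> 'w measure" and X :: "real \<Rightarrow> 'w \<Rightarrow> ereal"
    and S :: "real \<Rightarrow> real" and m :: "real measure" and \<alpha> \<beta> :: real
  assumes "regular_diffusion N P X"
    and "scale_function N P X S"
    and "\<exists>S'. continuous_on UNIV S' \<and> (\<forall>x. (S has_real_derivative S' x) (at x))"
    and "speed_measure P X S m"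
    and "\<exists>f :: real \<Rightarrow> real. continuous_on UNIV f \<and> (\<forall>x. 0 \<le> f x) \<and>
           m = density lborel (\<lambda>x. ennreal (f x))"
    and "(recurrent_diffusion N P X \<and> filterlim S at_top at_top \<and> filterlim S at_bot at_bot) \<or>
         (transient_diffusion N P X \<and> (\<exists>L. (S \<longlongrightarrow> L) at_top) \<and> filterlim S at_bot at_bot)"
    and "\<And>\<delta>. \<delta> > 0 \<Longrightarrow> AE \<omega> in P 0. drawdown_time X \<delta> \<omega> < \<infinity>"
    and "0 < \<beta>" and "\<beta> < \<alpha>"
  defines "D \<equiv> \<lambda>\<eta> \<omega>. max_drawdown X (hitting_time X \<eta> \<omega>) \<omega>"
    and "rhs \<equiv> \<lambda>\<delta> \<rho>. if \<delta> \<ge> \<rho>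
           then exp (- (LINT z:{\<beta>..\<alpha>}|interval_measure S. 1 / (S z - S (z - \<delta>)))) else 0"
  shows "(\<exists>\<kappa>. regular_conditional_distribution (P 0) borel (D \<alpha>) borel (D \<beta>) \<kappa> \<and>
            (\<forall>\<rho>>0. \<forall>\<delta>>0. measure (\<kappa> (ereal \<rho>)) {..ereal \<delta>} = rhs \<delta> \<rho>)) \<and>
         (\<forall>\<kappa>. regular_conditional_distribution (P 0) borel (D \<alpha>) borel (D \<beta>) \<kappa> \<longrightarrow>
            (AE z in distr (P 0) borel (D \<beta>). \<forall>\<rho>>0. z = ereal \<rho> \<longrightarrow>
               (\<forall>\<delta>>0. measure (\<kappa> z) {..ereal \<delta>} = rhs \<delta> \<rho>)))"
proof -
  interpret regular_diffusion N P X by fact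
  have bot: "filterlim S at_bot at_bot" using assms(6) by blast
  have diff: "\<exists>D. (S has_real_derivative D) (at x)" for x using assms(3) by blast
  have fin: "AE \<omega> in P x. hitting_time X y \<omega> < \<infinity>" if "x \<le> y" for x y
    by (rule hitting_time_finite[OF assms(2,4) bot that])
  have D[measurable]: "D \<eta> \<in> borel_measurable (P x)" for \<eta> x
    unfolding D_def measurable_cong_sets[OF sets_P refl] by (rule measurable_hit_drawdown)
  define \<nu> where "\<nu> = distr (P \<beta>) borel (D \<alpha>)"
  have \<nu>: "prob_space \<nu>" "sets \<nu> = sets borel"
    unfolding \<nu>_def by (auto intro: prob_space.prob_space_distr prob_space_P D)
  have \<nu>_atMost: "emeasure \<nu> {..d} = emeasure (P \<beta>) {\<omega>\<in>space N. D \<alpha> \<omega> \<le> d}" for d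
    unfolding \<nu>_def by (subst emeasure_distr)
      (auto intro!: arg_cong[where f = "emeasure (P \<beta>)"] D simp: space_P)
  let ?\<kappa> = "\<lambda>z. distr \<nu> borel (max z)"
  have rcd: "regular_conditional_distribution (P 0) borel (D \<alpha>) borel (D \<beta>) ?\<kappa>"
  proof (rule regular_conditional_distribution_max[OF prob_space_P D D \<nu>])
    fix B :: "ereal set" and d assume "B \<in> sets borel"
    from strong_markov_drawdown[OF _ _ this fin, of 0 \<beta> \<alpha> d]
    show "emeasure (P 0) {\<omega>\<in>space (P 0). D \<beta> \<omega> \<in> B \<and> D \<alpha> \<omega> \<le> d} =
        emeasure (P 0) {\<omega>\<in>space (P 0). D \<beta> \<omega> \<in> B \<and> D \<beta> \<omega> \<le> d} * emeasure \<nu> {..d}"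
      using assms(8,9) by (simp add: D_def \<nu>_atMost space_P)
  qed
  have \<kappa>_atMost: "measure (?\<kappa> (ereal \<rho>)) {..ereal \<delta>} = rhs \<delta> \<rho>" if "0 < \<delta>" for \<rho> \<delta>
    using drawdown_probability[OF assms(2) diff fin that less_imp_le[OF assms(9)]]
    by (simp add: measure_def emeasure_distr_max[OF \<nu>(2)] \<nu>_atMost rhs_def D_def)
  show ?thesis
  proof (intro conjI exI allI impI)
    show "regular_conditional_distribution (P 0) borel (D \<alpha>) borel (D \<beta>) ?\<kappa>" by (rule rcd)
    show "measure (?\<kappa> (ereal \<rho>)) {..ereal \<delta>} = rhs \<delta> \<rho>" if "0 < \<delta>" for \<rho> \<delta>
      using that by (rule \<kappa>_atMost)
    fix \<kappa> assume "regular_conditional_distribution (P 0) borel (D \<alpha>) borel (D \<beta>) \<kappa>"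
    from regular_conditional_distribution_AE_unique[OF prob_space_P this rcd]
    show "AE z in distr (P 0) borel (D \<beta>). \<forall>\<rho>>0. z = ereal \<rho> \<longrightarrow>
        (\<forall>\<delta>>0. measure (\<kappa> z) {..ereal \<delta>} = rhs \<delta> \<rho>)"
      by eventually_elim (auto simp: \<kappa>_atMost)
  qed
qed

end
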